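(* Let $k\ge1$. For all linear functions $f(x)=mx+b$ with $m,b\in\mathbb{R}$, $m\ne0$, and all $0\le\mu\le1$, there exists a Borel set $E\subset J^k(\mathbb{R})$ such that for all $t\in\mathbb{R}$, $$\dim_{\mathrm{Hau}}(E)=\mu\quad\text{and}\quad\dim_{\mathrm{Hau}}(V_{f,t}(E))=(k+1)\mu.$$
   Context: Let $k\ge 1$ be an integer. The jet space Carnot group $J^k(\mathbb{R})$ is the set $\mathbb{R}^{k+2}$, with points written $(x,u_k,\ldots,u_0)$, equipped with the group operation $(x,u_k,\ldots,u_0)\odot(y,v_k,\ldots,v_0)=(x+y,w_k,\ldots,w_0)$, where $w_k=u_k+v_k$ and $w_s=u_s+v_s+\sum_{j=s+1}^k u_j\frac{y^{j-s}}{(j-s)!}$ for $s=0,\ldots,k-1$; inverses $p^{-1}$ are with respect to $\odot$. The horizontal bundle is framed by the left-invariant vector fields $X^{(k)}=\frac{\partial}{\partial x}+u_k\frac{\partial}{\partial u_{k-1}}+\cdots+u_1\frac{\partial}{\partial u_0}$ and $\frac{\partial}{\partial u_k}$, declared orthonormal; a horizontal curve is a curve that is absolutely continuous into $\mathbb{R}^{k+2}$ and whose derivative lies a.e. in the horizontal bundle. The Carnot–Carathéodory distance $d_{cc}(p,q)$ is the infimum of lengths of horizontal curves connecting $p$ to $q$. $\dim_{\mathrm{Hau}}$ of subsets of $J^k(\mathbb{R})$ is Hausdorff dimension with respect to $d_{cc}$ (with $\dim_{\mathrm{Hau}}\emptyset=0$). For $f\in C^\infty(\mathbb{R})$ and $x\in\mathbb{R}$,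 $j^k_x(f):=(x,f^{(k)}(x),f^{(k-1)}(x),\ldots,f(x))\in J^k(\mathbb{R})$. For $t\in\mathbb{R}$, $\{x=t\}:=\{(x,u_k,\ldots,u_0)\in J^k(\mathbb{R}):x=t\}$. For $f\in C^\infty(\mathbb{R})$ and $t\in\mathbb{R}$, the vertical mapping $V_{f,t}:J^k(\mathbb{R})\to\{x=t\}$ is $V_{f,t}(x,u_k,\ldots,u_0):=(x,u_k,\ldots,u_0)\odot j^k_{x-t}(f)^{-1}$. *)

theory Defs
  imports "HOL-Analysis.Analysis" "HOL-Algebra.Group"
begin

section \<open>Hausdorff dimension with respect to an extended metric\<close>

text \<open>
  The ambient space is a set \<open>S\<close> with a distance \<open>d\<close> taking values in \<open>[0,\<infinity>]\<close>;
  the topology of the type plays no role here.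
\<close>

definition set_diam :: "('a \<Rightarrow> 'a \<Rightarrow> ennreal) \<Rightarrow> 'a set \<Rightarrow> ennreal" where
  "set_diam d U = (SUP p\<in>U. SUP q\<in>U. d p q)"

text \<open>
  Covering sets have diameter at most the finite number \<open>\<delta>\<close>, so \<^const>\<open>enn2real\<close> loses nothing.
  The definition is meant for \<open>s > 0\<close> only: since \<open>0 powr 0 = 0\<close> in HOL, it would not yield
  counting measure at \<open>s = 0\<close>.
\<close>

definition hausdorff_content ::
  "'a set \<Rightarrow> ('a \<Rightarrow> 'a \<Rightarrow> ennreal) \<Rightarrow> real \<Rightarrow> real \<Rightarrow> 'a set \<Rightarrow> ennreal" where
  "hausdorff_content S d s \<delta> E =
     (INF U\<in>{U :: nat \<Rightarrow> 'a set. (\<forall>i. U i \<subseteq> S \<and> set_diam d (U i) \<le> ennreal \<delta>) \<and> E \<subseteq> (\<Union>i. U i)}.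
        \<Sum>i. ennreal (enn2real (set_diam d (U i)) powr s))"

definition hausdorff_measure ::
  "'a set \<Rightarrow> ('a \<Rightarrow> 'a \<Rightarrow> ennreal) \<Rightarrow> real \<Rightarrow> 'a set \<Rightarrow> ennreal" where
  "hausdorff_measure S d s E = (SUP \<delta>\<in>{0<..}. hausdorff_content S d s \<delta> E)"

text \<open>
  Omitting the exponent \<open>s = 0\<close> does not change the infimum, because the measures vanish for
  all exponents above one at which they vanish. The empty set has dimension \<open>0\<close>.
\<close>

definition hausdorff_dim :: "'a set \<Rightarrow> ('a \<Rightarrow> 'a \<Rightarrow> ennreal) \<Rightarrow> 'a set \<Rightarrow> ennreal" where
  "hausdorff_dim S d E = (INF s\<in>{s. 0 < s \<and> hausdorff_measure S d s E = 0}. ennreal s)"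

section \<open>The jet space Carnot group\<close>

text \<open>
  The point \<open>(x, u\<^sub>k, \<dots>, u\<^sub>0)\<close> of \<open>\<real>\<^sup>k\<^sup>+\<^sup>2\<close> is the pair \<open>(x, u)\<close>, with \<open>u s\<close> the coordinate \<open>u\<^sub>s\<close>
  for \<open>s \<le> k\<close> and \<open>u s = 0\<close> for \<open>s > k\<close>. The type carries the product topology,
  in which \<open>jet_space k\<close> is a closed subset homeomorphic to \<open>\<real>\<^sup>k\<^sup>+\<^sup>2\<close>. So the Borel sets of
  \<open>\<real>\<^sup>k\<^sup>+\<^sup>2\<close> are the sets \<open>E \<subseteq> jet_space k\<close> with \<open>E \<in> sets borel\<close>.
\<close>

type_synonym jet = "real \<times> (nat \<Rightarrow> real)"

definition jet_space :: "nat \<Rightarrow> jet set" where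
  "jet_space k = {p. \<forall>s>k. snd p s = 0}"

text \<open>The sum is empty for \<open>s = k\<close>, so that coordinate is \<open>u\<^sub>k + v\<^sub>k\<close>.\<close>

definition jet_mult :: "nat \<Rightarrow> jet \<Rightarrow> jet \<Rightarrow> jet" where
  "jet_mult k p q =
     (fst p + fst q,
      \<lambda>s. snd p s + snd q s + (\<Sum>j\<in>{s+1..k}. snd p j * (fst q ^ (j - s) / fact (j - s))))"

definition jet_group :: "nat \<Rightarrow> jet monoid" where
  "jet_group k = \<lparr>carrier = jet_space k, mult = jet_mult k, one = (0, \<lambda>_. 0)\<rparr>"

section \<open>Horizontal curves and the Carnot--Caratheodory distance\<close>

definition field_X :: "nat \<Rightarrow> jet \<Rightarrow> jet" where
  "field_X k p = (1, \<lambda>s. if s < k then snd p (s + 1) else 0)"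

definition field_U :: "nat \<Rightarrow> jet \<Rightarrow> jet" where
  "field_U k p = (0, \<lambda>s. if s = k then 1 else 0)"

definition frame_comb :: "nat \<Rightarrow> jet \<Rightarrow> real \<Rightarrow> real \<Rightarrow> jet" where
  "frame_comb k p \<alpha> \<beta> =
     (\<alpha> * fst (field_X k p) + \<beta> * fst (field_U k p),
      \<lambda>s. \<alpha> * snd (field_X k p) s + \<beta> * snd (field_U k p) s)"

definition horizontal_space :: "nat \<Rightarrow> jet \<Rightarrow> jet set" where
  "horizontal_space k p = {frame_comb k p \<alpha> \<beta> | \<alpha> \<beta>. True}"

text \<open>
  The coefficients of a horizontal vector in the orthonormal frame are its \<open>x\<close>- and
  \<open>u\<^sub>k\<close>-components; see \<open>horizontal_norm_frame_comb\<close>.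
\<close>

definition horizontal_norm :: "nat \<Rightarrow> jet \<Rightarrow> real" where
  "horizontal_norm k v = sqrt ((fst v)\<^sup>2 + (snd v k)\<^sup>2)"

lemma horizontal_norm_frame_comb:
  "horizontal_norm k (frame_comb k p \<alpha> \<beta>) = sqrt (\<alpha>\<^sup>2 + \<beta>\<^sup>2)"
  by (simp add: horizontal_norm_def frame_comb_def field_X_def field_U_def)

definition euclid_dist :: "nat \<Rightarrow> jet \<Rightarrow> jet \<Rightarrow> real" where
  "euclid_dist k p q = sqrt ((fst p - fst q)\<^sup>2 + (\<Sum>s\<le>k. (snd p s - snd q s)\<^sup>2))"

definition abs_continuous_on ::
  "('a \<Rightarrow> 'a \<Rightarrow> real) \<Rightarrow> real \<Rightarrow> real \<Rightarrow> (real \<Rightarrow> 'a) \<Rightarrow> bool" where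
  "abs_continuous_on d a b \<gamma> \<longleftrightarrow>
     (\<forall>\<epsilon>>0. \<exists>\<delta>>0. \<forall>(n::nat) l r.
        (\<forall>i<n. a \<le> l i \<and> l i \<le> r i \<and> r i \<le> b) \<longrightarrow>
        (\<forall>i<n. \<forall>j<n. i \<noteq> j \<longrightarrow> {l i<..<r i} \<inter> {l j<..<r j} = {}) \<longrightarrow>
        (\<Sum>i<n. r i - l i) < \<delta> \<longrightarrow>
        (\<Sum>i<n. d (\<gamma> (l i)) (\<gamma> (r i))) < \<epsilon>)"

definition has_velocity :: "(real \<Rightarrow> jet) \<Rightarrow> jet \<Rightarrow> real \<Rightarrow> bool" where
  "has_velocity \<gamma> v \<tau> \<longleftrightarrow>
     ((\<lambda>r. fst (\<gamma> r)) has_real_derivative fst v) (at \<tau>) \<and>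
     (\<forall>s. ((\<lambda>r. snd (\<gamma> r) s) has_real_derivative snd v s) (at \<tau>))"

definition velocity :: "(real \<Rightarrow> jet) \<Rightarrow> real \<Rightarrow> jet" where
  "velocity \<gamma> \<tau> = (deriv (\<lambda>r. fst (\<gamma> r)) \<tau>, \<lambda>s. deriv (\<lambda>r. snd (\<gamma> r) s) \<tau>)"

definition horizontal_curve :: "nat \<Rightarrow> real \<Rightarrow> real \<Rightarrow> (real \<Rightarrow> jet) \<Rightarrow> bool" where
  "horizontal_curve k a b \<gamma> \<longleftrightarrow>
     (\<forall>\<tau>\<in>{a..b}. \<gamma> \<tau> \<in> jet_space k) \<and>
     abs_continuous_on (euclid_dist k) a b \<gamma> \<and>
     (AE \<tau> in lebesgue_on {a..b}. \<exists>v\<in>horizontal_space k (\<gamma> \<tau>). has_velocity \<gamma> v \<tau>)"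

definition curve_length :: "nat \<Rightarrow> real \<Rightarrow> real \<Rightarrow> (real \<Rightarrow> jet) \<Rightarrow> ennreal" where
  "curve_length k a b \<gamma> =
     (\<integral>\<^sup>+\<tau>. ennreal (horizontal_norm k (velocity \<gamma> \<tau>)) \<partial>lebesgue_on {a..b})"

definition d_cc :: "nat \<Rightarrow> jet \<Rightarrow> jet \<Rightarrow> ennreal" where
  "d_cc k p q =
     Inf {curve_length k a b \<gamma> | a b \<gamma>. a \<le> b \<and> horizontal_curve k a b \<gamma> \<and> \<gamma> a = p \<and> \<gamma> b = q}"

abbreviation jet_dim :: "nat \<Rightarrow> jet set \<Rightarrow> ennreal" where
  "jet_dim k \<equiv> hausdorff_dim (jet_space k) (d_cc k)"

section \<open>Jets of functions and vertical mappings\<close>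

definition jet_of :: "nat \<Rightarrow> (real \<Rightarrow> real) \<Rightarrow> real \<Rightarrow> jet" where
  "jet_of k f x = (x, \<lambda>s. if s \<le> k then (deriv ^^ s) f x else 0)"

definition vertical_map :: "nat \<Rightarrow> (real \<Rightarrow> real) \<Rightarrow> real \<Rightarrow> jet \<Rightarrow> jet" where
  "vertical_map k f t p =
     p \<otimes>\<^bsub>jet_group k\<^esub> inv\<^bsub>jet_group k\<^esub> (jet_of k f (fst p - t))"

end

theory Submission
  imports Defs "HOL-Computational_Algebra.Polynomial"
begin

text \<open>
For \<open>\<mu> = 0\<close> the empty set works. For \<open>\<mu> > 0\<close> let
\<open>C\<close> be the Cantor set obtained by keeping two intervals of relative length \<open>r =
2 powr (- 1 / \<mu>)\<close> at each stage, so that \<open>C\<close> has dimension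
\<open>\<mu>\<close> on the line, let \<open>A = C \<union> (C + 3)\<close>, and let
\<open>E\<close> consist of the \<open>k\<close>-jets at the points of \<open>A\<close> of the
monomial \<open>x ^ (k + 1) / fact (k + 1)\<close>.

The \<open>k\<close>-jets of this function form a horizontal curve of bounded speed, and the
distance is never smaller than the difference of the \<open>x\<close>-coordinates, so
\<open>E\<close> is bi-Lipschitz to \<open>A\<close> and has dimension \<open>\<mu>\<close>. The
vertical mapping transports the jet at \<open>x\<close> to the fibre over \<open>t\<close> by
Taylor expansion, and subtracts a jet not depending on \<open>x\<close>. The jets of a polynomial
of degree at most \<open>k\<close> would all be sent to a single point. The monomial has degree
\<open>k + 1\<close> and leaves the error of its Taylor expansion: up to additive constants, the
coordinate \<open>u\<^sub>s\<close> of the image is \<open>- (t - x) ^ (k + 1 - s) / fact (k + 1 -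
s)\<close> (\<open>vertical_map_monomial_jet\<close>).

For bounded \<open>x\<close>, all coordinates of the image are thus Lipschitz in \<open>x\<close>,
and \<open>u\<^sub>0\<close> is bi-Lipschitz in \<open>x\<close> on either side of
\<open>t\<close>, as long as \<open>\<bar>t - x\<bar> \<ge> 1\<close>. Inside a fibre a difference
of size \<open>\<epsilon>\<close> in \<open>u\<^sub>0\<close> costs at least a multiple of
\<open>\<epsilon> powr (1 / (k + 1))\<close> (\<open>vertical_diff_le_d_cc\<close>), and changes
of all the coordinates by at most \<open>\<epsilon> \<le> 1\<close> cost at most a multiple of it
(\<open>fibre_box_in_ball\<close>). So the map from \<open>x\<close> to the image point raises
distances to the power \<open>1 / (k + 1)\<close>, up to constant factors, and multiplies
dimensions by \<open>k + 1\<close>. One of \<open>C\<close> and \<open>C + 3\<close> always has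
distance at least \<open>1\<close> from \<open>t\<close>, which gives the lower bound for every
\<open>t\<close> with one and the same set.

The lower bounds for the distance integrate derivatives along horizontal curves, which are merely
absolutely continuous. They rest on the fundamental theorem of calculus for such functions,
\<open>has_integral_derivative_of_ac\<close>. The upper bounds come from explicit piecewise smooth
curves.
\<close>

section \<open>Absolutely continuous functions on the line\<close>

abbreviation ac_on :: "real \<Rightarrow> real \<Rightarrow> (real \<Rightarrow> real) \<Rightarrow> bool" where
  "ac_on a b f \<equiv> abs_continuous_on (\<lambda>x y. \<bar>x - y\<bar>) a b f"

text \<open>
The tagged divisions of a gauge integral are sets of pairs, not sequences, so the estimate
defining absolute continuity is wanted for families over arbitrary finite index sets.
\<close>

lemma ac_onD_finite_family:
  assumes "ac_on a b f" "e > 0"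
  obtains d where "d > 0"
    "\<And>(I::'i set) l r. finite I \<Longrightarrow> (\<And>i. i \<in> I \<Longrightarrow> a \<le> l i \<and> l i \<le> r i \<and> r i \<le> b) \<Longrightarrow>
       (\<And>i j. i \<in> I \<Longrightarrow> j \<in> I \<Longrightarrow> i \<noteq> j \<Longrightarrow> {l i<..<r i} \<inter> {l j<..<r j} = {}) \<Longrightarrow>
       (\<Sum>i\<in>I. r i - l i) < d \<Longrightarrow> (\<Sum>i\<in>I. \<bar>f (l i) - f (r i)\<bar>) < e"
proof -
  obtain d where d: "d > 0" and
    D0: "\<forall>(n::nat) l r. (\<forall>i<n. a \<le> l i \<and> l i \<le> r i \<and> r i \<le> b) \<longrightarrow>
        (\<forall>i<n. \<forall>j<n. i \<noteq> j \<longrightarrow> {l i<..<r i} \<inter> {l j<..<r j} = {}) \<longrightarrow>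
        (\<Sum>i<n. r i - l i) < d \<longrightarrow> (\<Sum>i<n. \<bar>f (l i) - f (r i)\<bar>) < e"
    using assms unfolding abs_continuous_on_def by (elim allE[of _ e] impE exE conjE) simp_all
  have D: "(\<Sum>i<n. \<bar>f (l i) - f (r i)\<bar>) < e"
    if "\<And>i. i<n \<Longrightarrow> a \<le> l i \<and> l i \<le> r i \<and> r i \<le> b"
      "\<And>i j. i<n \<Longrightarrow> j<n \<Longrightarrow> i \<noteq> j \<Longrightarrow> {l i<..<r i} \<inter> {l j<..<r j} = {}"
      "(\<Sum>i<n. r i - l i) < d" for n :: nat and l r :: "nat \<Rightarrow> real"
    by (rule D0[THEN spec, THEN spec, THEN spec, THEN mp, THEN mp, THEN mp]) (use that in blast)+
  show ?thesis
  proof (rule that[OF d])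
    fix I :: "'i set" and l r :: "'i \<Rightarrow> real"
    assume I: "finite I" and lr: "\<And>i. i \<in> I \<Longrightarrow> a \<le> l i \<and> l i \<le> r i \<and> r i \<le> b"
      and dj: "\<And>i j. i \<in> I \<Longrightarrow> j \<in> I \<Longrightarrow> i \<noteq> j \<Longrightarrow> {l i<..<r i} \<inter> {l j<..<r j} = {}"
      and s: "(\<Sum>i\<in>I. r i - l i) < d"
    obtain h where "bij_betw h {0..<card I} I" using ex_bij_betw_nat_finite[OF I] by blast
    then have h: "bij_betw h {..<card I} I" by (simp add: atLeast0LessThan)
    have mem: "h i \<in> I" if "i < card I" for i using h that by (auto simp: bij_betw_def)
    have inj: "h i \<noteq> h j" if "i < card I" "j < card I" "i \<noteq> j" for i j
      using h that by (auto simp: bij_betw_def inj_on_def)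
    have "(\<Sum>i<card I. \<bar>f (l (h i)) - f (r (h i))\<bar>) < e"
    proof (rule D)
      show "(\<Sum>i<card I. r (h i) - l (h i)) < d"
        using s sum.reindex_bij_betw[OF h, of "\<lambda>i. r i - l i"] by simp
    qed (use lr dj mem inj in auto)
    then show "(\<Sum>i\<in>I. \<bar>f (l i) - f (r i)\<bar>) < e"
      using sum.reindex_bij_betw[OF h, of "\<lambda>i. \<bar>f (l i) - f (r i)\<bar>"] by simp
  qed
qed

lemma sum_length_le_measure:
  fixes l r :: "'i \<Rightarrow> real"
  assumes I: "finite I" and lr: "\<And>i. i \<in> I \<Longrightarrow> l i \<le> r i"
    and dj: "\<And>i j. i \<in> I \<Longrightarrow> j \<in> I \<Longrightarrow> i \<noteq> j \<Longrightarrow> {l i<..<r i} \<inter> {l j<..<r j} = {}"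
    and T: "T \<in> lmeasurable" and sub: "\<And>i. i \<in> I \<Longrightarrow> {l i<..<r i} \<subseteq> T"
  shows "(\<Sum>i\<in>I. r i - l i) \<le> measure lebesgue T"
proof -
  have m: "{l i<..<r i} \<in> lmeasurable" for i using lmeasurable_box[of "l i" "r i"] by simp
  have "(\<Sum>i\<in>I. r i - l i) = (\<Sum>i\<in>I. measure lebesgue {l i<..<r i})"
    by (rule sum.cong) (use lr in auto)
  also have "\<dots> = measure lebesgue (\<Union>i\<in>I. {l i<..<r i})"
    by (rule measure_UNION'[symmetric]) (use I m dj in \<open>auto simp: pairwise_def disjnt_def\<close>)
  also have "\<dots> \<le> measure lebesgue T"
    by (rule measure_mono_fmeasurable) (use sub T m I in \<open>auto intro!: fmeasurableD\<close>)
  finally show ?thesis .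
qed

text \<open>
The derivative may fail to exist on a null set \<open>N\<close>. In a fine enough tagged division,
the intervals tagged outside \<open>N\<close> contribute little by differentiability. Those tagged
in \<open>N\<close> lie in an open set of small measure, so their total length is small, and
absolute continuity makes the total increment of \<open>f\<close> over them small.
\<close>

lemma has_integral_derivative_of_ac:
  fixes f D :: "real \<Rightarrow> real"
  assumes ab: "a \<le> b" and ac: "ac_on a b f"
    and N: "negligible N"
    and der: "\<And>x. x \<in> {a..b} - N \<Longrightarrow> (f has_real_derivative D x) (at x)"
    and D0: "\<And>x. x \<in> N \<Longrightarrow> D x = 0"
  shows "(D has_integral (f b - f a)) {a..b}"
  unfolding has_integral_real
proof (intro allI impI)
  fix e :: real assume "e > 0"
  define e' where "e' = e / (2 * (b - a + 1))"
  have e': "e' > 0" "e' * (b - a) < e / 2"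
  proof -
    show "e' > 0" using \<open>e > 0\<close> ab by (simp add: e'_def)
    moreover have "e' * (b - a + 1) = e / 2" using ab by (simp add: e'_def divide_simps)
    ultimately show "e' * (b - a) < e / 2" by (simp add: algebra_simps)
  qed
  obtain \<delta> where \<delta>: "\<delta> > 0" and AC:
    "\<And>(I::(real \<times> real set) set) l r. finite I \<Longrightarrow> (\<And>i. i \<in> I \<Longrightarrow> a \<le> l i \<and> l i \<le> r i \<and> r i \<le> b) \<Longrightarrow>
       (\<And>i j. i \<in> I \<Longrightarrow> j \<in> I \<Longrightarrow> i \<noteq> j \<Longrightarrow> {l i<..<r i} \<inter> {l j<..<r j} = {}) \<Longrightarrow>
       (\<Sum>i\<in>I. r i - l i) < \<delta> \<Longrightarrow> (\<Sum>i\<in>I. \<bar>f (l i) - f (r i)\<bar>) < e/2"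
    by (rule ac_onD_finite_family[OF ac half_gt_zero[OF \<open>e > 0\<close>], where 'i = "real \<times> real set"]) blast
  \<comment> \<open>The intervals tagged at exceptional points will be kept inside \<open>T\<close>.\<close>
  obtain T where T: "open T" "N \<subseteq> T" "T \<in> lmeasurable" "measure lebesgue T < \<delta>"
  proof -
    have "N \<in> null_sets lebesgue" using N negligible_iff_null_sets by blast
    then obtain T where T: "open T" "N \<subseteq> T" "(T - N) \<in> lmeasurable" "emeasure lebesgue (T - N) < ennreal \<delta>"
      using sets_lebesgue_outer_open[of N \<delta>] \<delta> by (metis null_setsD2)
    have "T \<in> lmeasurable" "measure lebesgue T = measure lebesgue (T - N)"
    proof -
      have "(T - N) \<union> N \<in> lmeasurable"
        using T(3) N negligible_imp_measurable by (intro fmeasurable.Un) auto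
      then show tm: "T \<in> lmeasurable" using T(2) by (simp add: Un_absorb2)
      show "measure lebesgue T = measure lebesgue (T - N)"
        using measure_Diff_null_set[OF fmeasurableD[OF tm] \<open>N \<in> null_sets lebesgue\<close>] by simp
    qed
    moreover have "measure lebesgue (T - N) < \<delta>"
      using T(3,4) \<delta> by (simp add: emeasure_eq_measure2 ennreal_less_iff)
    ultimately show ?thesis using that T by auto
  qed
  have "\<exists>d>0. (x \<in> {a..b} - N \<longrightarrow> (\<forall>y. \<bar>y - x\<bar> < d \<longrightarrow> \<bar>f y - f x - D x * (y - x)\<bar> \<le> e' * \<bar>y - x\<bar>)) \<and>
     (x \<in> N \<longrightarrow> ball x d \<subseteq> T)" for x
  proof (cases "x \<in> N")
    case True
    then show ?thesis using T(1,2) open_contains_ball by (metis Diff_iff subsetD)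
  next
    case False
    show ?thesis
    proof (cases "x \<in> {a..b}")
      case True
      have "(f has_derivative (*) (D x)) (at x)"
        using der[of x] True False by (simp add: has_field_derivative_def)
      then obtain d where "d > 0" "\<forall>y. \<bar>y - x\<bar> < d \<longrightarrow> \<bar>f y - f x - D x * (y - x)\<bar> \<le> e' * \<bar>y - x\<bar>"
        using e' unfolding has_derivative_at_alt by (metis real_norm_def)
      then show ?thesis using False by blast
    qed (use False in \<open>auto intro: exI[of _ 1]\<close>)
  qed
  then obtain d where d: "\<And>x. d x > 0"
    "\<And>x y. x \<in> {a..b} - N \<Longrightarrow> \<bar>y - x\<bar> < d x \<Longrightarrow> \<bar>f y - f x - D x * (y - x)\<bar> \<le> e' * \<bar>y - x\<bar>"
    "\<And>x. x \<in> N \<Longrightarrow> ball x (d x) \<subseteq> T" by metis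
  show "\<exists>\<gamma>. gauge \<gamma> \<and> (\<forall>\<D>. \<D> tagged_division_of {a..b} \<and> \<gamma> fine \<D> \<longrightarrow>
      norm ((\<Sum>(x, k)\<in>\<D>. measure lborel k *\<^sub>R D x) - (f b - f a)) < e)"
  proof (intro exI conjI allI impI; (elim conjE)?)
    show "gauge (\<lambda>x. ball x (d x))" using d(1) gauge_ball_dependent by blast
    fix p assume p: "p tagged_division_of {a..b}" and fine: "(\<lambda>x. ball x (d x)) fine p"
    have fin: "finite p" using p by blast
    define l where "l = (\<lambda>z::real \<times> real set. Inf (snd z))"
    define r where "r = (\<lambda>z::real \<times> real set. Sup (snd z))"
    have pK: "K = {l (x,K)..r (x,K)}" "l (x,K) \<le> x" "x \<le> r (x,K)" "a \<le> l (x,K)" "r (x,K) \<le> b" "x \<in> {a..b}"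
      "{l (x,K)..r (x,K)} \<subseteq> ball x (d x)"
      if z: "(x,K) \<in> p" for x K
    proof -
      obtain u v where K: "K = cbox u v" using p z by blast
      have xK: "x \<in> K" "K \<subseteq> {a..b}" using p z by blast+
      then have uv: "u \<le> x" "x \<le> v" using K by auto
      then have lr: "l (x,K) = u" "r (x,K) = v" using K by (auto simp: l_def r_def)
      have bK: "K \<subseteq> ball x (d x)" using fine z by (auto simp: fine_def)
      show "K = {l (x,K)..r (x,K)}" "l (x,K) \<le> x" "x \<le> r (x,K)" "a \<le> l (x,K)" "r (x,K) \<le> b" "x \<in> {a..b}"
      "{l (x,K)..r (x,K)} \<subseteq> ball x (d x)"
        unfolding lr using K uv xK bK by auto
    qed
    have pz: "l z \<le> fst z" "fst z \<le> r z" "l z \<le> r z" "a \<le> l z" "r z \<le> b" "fst z \<in> {a..b}"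
      "{l z..r z} \<subseteq> ball (fst z) (d (fst z))" if "z \<in> p" for z
    proof -
      obtain x K where z: "z = (x, K)" by (cases z)
      show "l z \<le> fst z" "fst z \<le> r z" "l z \<le> r z" "a \<le> l z" "r z \<le> b" "fst z \<in> {a..b}"
        "{l z..r z} \<subseteq> ball (fst z) (d (fst z))"
        using pK(2-7)[of x K] that unfolding z by simp_all
    qed
    have con: "measure lborel (snd z) = r z - l z" if "z \<in> p" for z
      using pK[of "fst z" "snd z"] that by (metis content_real order_trans prod.collapse)
    have dj: "{l z<..<r z} \<inter> {l w<..<r w} = {}" if "z \<in> p" "w \<in> p" "z \<noteq> w" for z w
    proof -
      have "interior (snd z) \<inter> interior (snd w) = {}"
        using tagged_division_ofD(5)[OF p, of "fst z" "snd z" "fst w" "snd w"] that by auto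
      moreover have "interior (snd u) = {l u<..<r u}" if "u \<in> p" for u
        using pK(1)[of "fst u" "snd u"] that by (metis interior_atLeastAtMost_real prod.collapse)
      ultimately show ?thesis using that by simp
    qed
    define B where "B = {z \<in> p. fst z \<in> N}"
    have B: "finite B" "B \<subseteq> p" using fin by (auto simp: B_def)
    have fba: "f b - f a = (\<Sum>z\<in>p. f (r z) - f (l z))"
      using additive_tagged_division_1[OF ab p, of f] by (simp add: l_def r_def case_prod_beta)
    have ba: "(\<Sum>z\<in>p. r z - l z) = b - a"
      using additive_tagged_division_1[OF ab p, of "\<lambda>x. x"] by (simp add: l_def r_def case_prod_beta)
    have bad: "(\<Sum>z\<in>B. \<bar>f (l z) - f (r z)\<bar>) < e/2"
    proof (rule AC[OF B(1)])
      have "(\<Sum>z\<in>B. r z - l z) \<le> measure lebesgue T"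
      proof (rule sum_length_le_measure)
        show "l z \<le> r z" if "z \<in> B" for z
          using that pz[of z] by (auto simp: B_def)
        show "{l z<..<r z} \<subseteq> T" if "z \<in> B" for z
        proof -
          have "{l z..r z} \<subseteq> ball (fst z) (d (fst z))" "fst z \<in> N"
            using that pz(7)[of z] by (auto simp: B_def)
          then show ?thesis using d(3)[of "fst z"] by force
        qed
        show "{l z<..<r z} \<inter> {l w<..<r w} = {}" if "z \<in> B" "w \<in> B" "z \<noteq> w" for z w
          by (rule dj) (use that B in auto)
      qed (rule B T)+
      then show "(\<Sum>z\<in>B. r z - l z) < \<delta>" using T by linarith
      show "a \<le> l z \<and> l z \<le> r z \<and> r z \<le> b" if "z \<in> B" for z
        using that pz[of z] by (auto simp: B_def)
      show "{l z<..<r z} \<inter> {l w<..<r w} = {}" if "z \<in> B" "w \<in> B" "z \<noteq> w" for z w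
        by (rule dj) (use that B in auto)
    qed
    have good: "\<bar>measure lborel (snd z) * D (fst z) - (f (r z) - f (l z))\<bar> \<le> e' * (r z - l z)"
      if z: "z \<in> p - B" for z
    proof -
      let ?x = "fst z"
      note q = pz[of z]
      have zp: "z \<in> p" and xN: "?x \<notin> N" using z by (auto simp: B_def)
      have in1: "l z \<in> ball ?x (d ?x)" "r z \<in> ball ?x (d ?x)" using q zp by (auto simp: subset_iff)
      have x: "?x \<in> {a..b} - N" using q(6) zp xN by auto
      have "\<bar>f (l z) - f ?x - D ?x * (l z - ?x)\<bar> \<le> e' * \<bar>l z - ?x\<bar>"
        "\<bar>f (r z) - f ?x - D ?x * (r z - ?x)\<bar> \<le> e' * \<bar>r z - ?x\<bar>"
        using in1 by (auto intro!: d(2)[OF x] simp: dist_real_def)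
      moreover have "e' * \<bar>l z - ?x\<bar> = e' * ?x - e' * l z" "e' * \<bar>r z - ?x\<bar> = e' * r z - e' * ?x"
        using q(1,2) zp by (auto simp: algebra_simps)
      moreover have "measure lborel (snd z) * D ?x - (f (r z) - f (l z)) =
         (f (l z) - f ?x - D ?x * (l z - ?x)) - (f (r z) - f ?x - D ?x * (r z - ?x))"
        unfolding con[OF zp] by (simp add: algebra_simps)
      ultimately show ?thesis by (simp add: algebra_simps)
    qed
    define \<Delta> where "\<Delta> z = measure lborel (snd z) * D (fst z) - (f (r z) - f (l z))" for z
    have "(\<Sum>z\<in>p - B. \<bar>\<Delta> z\<bar>) \<le> (\<Sum>z\<in>p - B. e' * (r z - l z))"
      by (rule sum_mono) (use good in \<open>auto simp: \<Delta>_def\<close>)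
    also have "\<dots> \<le> (\<Sum>z\<in>p. e' * (r z - l z))"
    proof (rule sum_mono2[OF fin])
      fix z assume "z \<in> p - (p - B)"
      then have "l z \<le> r z" using pz(3)[of z] by auto
      then show "0 \<le> e' * (r z - l z)" using e' by simp
    qed auto
    also have "\<dots> = e' * (b - a)" by (simp flip: sum_distrib_left add: ba)
    finally have sum_good: "(\<Sum>z\<in>p - B. \<bar>\<Delta> z\<bar>) \<le> e' * (b - a)" .
    have sum_bad: "(\<Sum>z\<in>B. \<bar>\<Delta> z\<bar>) < e / 2"
    proof -
      have "(\<Sum>z\<in>B. \<bar>\<Delta> z\<bar>) = (\<Sum>z\<in>B. \<bar>f (l z) - f (r z)\<bar>)"
        by (rule sum.cong) (auto simp: \<Delta>_def B_def D0)
      then show ?thesis using bad by simp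
    qed
    have "(\<Sum>(x, k)\<in>p. measure lborel k *\<^sub>R D x) - (f b - f a) = (\<Sum>z\<in>p. \<Delta> z)"
      by (simp add: \<Delta>_def fba sum_subtractf case_prod_beta)
    moreover have "\<bar>\<Sum>z\<in>p. \<Delta> z\<bar> \<le> (\<Sum>z\<in>p. \<bar>\<Delta> z\<bar>)" by (rule sum_abs)
    moreover have "(\<Sum>z\<in>p. \<bar>\<Delta> z\<bar>) = (\<Sum>z\<in>p - B. \<bar>\<Delta> z\<bar>) + (\<Sum>z\<in>B. \<bar>\<Delta> z\<bar>)"
      by (rule sum.subset_diff[OF B(2) fin])
    ultimately show "norm ((\<Sum>(x, k)\<in>p. measure lborel k *\<^sub>R D x) - (f b - f a)) < e"
      using sum_good sum_bad e' by simp
  qed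
qed

text \<open>
Measurability of \<open>D\<close> is recorded because it allows constants to be moved out of the
integral on the right.
\<close>

lemma ac_increment_le_nn_integral:
  fixes f D :: "real \<Rightarrow> real"
  assumes ab: "a \<le> b" and ac: "ac_on a b f"
    and der: "AE x in lebesgue_on {a..b}. (f has_real_derivative D x) (at x)"
  shows "D \<in> borel_measurable (lebesgue_on {a..b})"
    and "ennreal \<bar>f b - f a\<bar> \<le> (\<integral>\<^sup>+x. ennreal \<bar>D x\<bar> \<partial>lebesgue_on {a..b})"
proof -
  define N where "N = {x \<in> {a..b}. \<not> (f has_real_derivative D x) (at x)}"
  have N: "negligible N"
  proof -
    have "AE x in lebesgue. x \<in> {a..b} \<longrightarrow> (f has_real_derivative D x) (at x)"
      using der by (simp add: AE_restrict_space_iff)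
    then have "AE x in lebesgue. x \<notin> N" by (rule AE_mp) (auto simp: N_def)
    then show ?thesis by (simp add: negligible_iff_null_sets completion.AE_iff_null_sets)
  qed
  define D' where "D' x = (if x \<in> N then 0 else D x)" for x
  have hi: "(D' has_integral (f b - f a)) {a..b}"
    by (rule has_integral_derivative_of_ac[OF ab ac N]) (auto simp: D'_def N_def)
  have hi2: "(D has_integral (f b - f a)) {a..b}"
    by (rule has_integral_spike[OF N _ hi]) (auto simp: D'_def)
  show m: "D \<in> borel_measurable (lebesgue_on {a..b})"
    using has_integral_implies_lebesgue_measurable_real[OF hi2]
    by (simp add: borel_measurable_restrict_space_iff mult.commute)
  show "ennreal \<bar>f b - f a\<bar> \<le> (\<integral>\<^sup>+x. ennreal \<bar>D x\<bar> \<partial>lebesgue_on {a..b})"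
  proof (cases "(\<integral>\<^sup>+x. ennreal \<bar>D x\<bar> \<partial>lebesgue_on {a..b}) < \<infinity>")
    case True
    then have i: "integrable (lebesgue_on {a..b}) D"
      using m by (simp add: integrable_iff_bounded)
    then have "f b - f a = integral\<^sup>L (lebesgue_on {a..b}) D"
      using has_integral_unique[OF hi2 has_integral_integral_lebesgue_on[OF i]] by simp
    then show ?thesis using integral_norm_bound_ennreal[OF i] by simp
  qed (simp add: not_less top.extremum_unique)
qed

text \<open>
The closure of absolutely continuous functions under coordinate projections, restriction to
subintervals, sums and products is obtained from this one comparison of increments. If a single
function dominates, it takes the place of both \<open>f\<close> and \<open>g\<close>, with
\<open>M = 1 / 2\<close>.
\<close>

lemma abs_continuous_on_dominated:
  assumes f: "abs_continuous_on d1 a b f" and g: "abs_continuous_on d2 a b g"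
    and sub: "a \<le> a'" "b' \<le> b" and M: "M > 0"
    and h: "\<And>x y. x \<in> {a'..b'} \<Longrightarrow> y \<in> {a'..b'} \<Longrightarrow> d (h x) (h y) \<le> M * (d1 (f x) (f y) + d2 (g x) (g y))"
  shows "abs_continuous_on d a' b' h"
  unfolding abs_continuous_on_def
proof (intro allI impI)
  fix e :: real assume "e > 0"
  then have e': "e / (2 * M) > 0" using M by simp
  obtain \<delta>1 where \<delta>1: "\<delta>1 > 0" and
    D1: "\<forall>(n::nat) l r. (\<forall>i<n. a \<le> l i \<and> l i \<le> r i \<and> r i \<le> b) \<longrightarrow>
        (\<forall>i<n. \<forall>j<n. i \<noteq> j \<longrightarrow> {l i<..<r i} \<inter> {l j<..<r j} = {}) \<longrightarrow>
        (\<Sum>i<n. r i - l i) < \<delta>1 \<longrightarrow> (\<Sum>i<n. d1 (f (l i)) (f (r i))) < e / (2 * M)"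
    using f e' unfolding abs_continuous_on_def by (elim allE[of _ "e / (2 * M)"] impE exE conjE) simp_all
  obtain \<delta>2 where \<delta>2: "\<delta>2 > 0" and
    D2: "\<forall>(n::nat) l r. (\<forall>i<n. a \<le> l i \<and> l i \<le> r i \<and> r i \<le> b) \<longrightarrow>
        (\<forall>i<n. \<forall>j<n. i \<noteq> j \<longrightarrow> {l i<..<r i} \<inter> {l j<..<r j} = {}) \<longrightarrow>
        (\<Sum>i<n. r i - l i) < \<delta>2 \<longrightarrow> (\<Sum>i<n. d2 (g (l i)) (g (r i))) < e / (2 * M)"
    using g e' unfolding abs_continuous_on_def by (elim allE[of _ "e / (2 * M)"] impE exE conjE) simp_all
  show "\<exists>\<delta>>0. \<forall>(n::nat) l r. (\<forall>i<n. a' \<le> l i \<and> l i \<le> r i \<and> r i \<le> b') \<longrightarrow>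
        (\<forall>i<n. \<forall>j<n. i \<noteq> j \<longrightarrow> {l i<..<r i} \<inter> {l j<..<r j} = {}) \<longrightarrow>
        (\<Sum>i<n. r i - l i) < \<delta> \<longrightarrow> (\<Sum>i<n. d (h (l i)) (h (r i))) < e"
  proof (intro exI[of _ "min \<delta>1 \<delta>2"] conjI allI impI)
    show "min \<delta>1 \<delta>2 > 0" using \<delta>1 \<delta>2 by simp
    fix n :: nat and l r :: "nat \<Rightarrow> real"
    assume lr': "\<forall>i<n. a' \<le> l i \<and> l i \<le> r i \<and> r i \<le> b'"
      and dj: "\<forall>i<n. \<forall>j<n. i \<noteq> j \<longrightarrow> {l i<..<r i} \<inter> {l j<..<r j} = {}"
      and s: "(\<Sum>i<n. r i - l i) < min \<delta>1 \<delta>2"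
    have lr: "\<forall>i<n. a \<le> l i \<and> l i \<le> r i \<and> r i \<le> b" using lr' sub by (meson order_trans)
    have 1: "(\<Sum>i<n. d1 (f (l i)) (f (r i))) < e / (2 * M)" using D1 lr dj s by simp
    have 2: "(\<Sum>i<n. d2 (g (l i)) (g (r i))) < e / (2 * M)" using D2 lr dj s by simp
    have "(\<Sum>i<n. d (h (l i)) (h (r i))) \<le> (\<Sum>i<n. M * (d1 (f (l i)) (f (r i)) + d2 (g (l i)) (g (r i))))"
    proof (rule sum_mono, rule h)
      fix i assume "i \<in> {..<n}"
      then have "a' \<le> l i" "l i \<le> r i" "r i \<le> b'" using lr' by auto
      then show "l i \<in> {a'..b'}" "r i \<in> {a'..b'}" by auto
    qed
    also have "\<dots> = M * ((\<Sum>i<n. d1 (f (l i)) (f (r i))) + (\<Sum>i<n. d2 (g (l i)) (g (r i))))"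
      by (simp add: sum_distrib_left sum.distrib distrib_left)
    also have "\<dots> < M * (e / (2 * M) + e / (2 * M))"
      using 1 2 M by (intro mult_strict_left_mono add_strict_mono) auto
    also have "\<dots> = e" using M by (simp add: field_simps)
    finally show "(\<Sum>i<n. d (h (l i)) (h (r i))) < e" .
  qed
qed

lemma ac_on_const: "ac_on a b (\<lambda>_. c)"
  unfolding abs_continuous_on_def by (auto intro: exI[of _ 1])

lemma ac_on_add: "ac_on a b f \<Longrightarrow> ac_on a b g \<Longrightarrow> ac_on a b (\<lambda>x. f x + g x)"
  by (rule abs_continuous_on_dominated[of _ a b f _ g _ _ 1]) auto

lemma ac_on_cmult:
  assumes "ac_on a b f" shows "ac_on a b (\<lambda>x. c * f x)"
proof (rule abs_continuous_on_dominated[OF assms assms order_refl order_refl, of "\<bar>c\<bar> + 1"])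
  fix x y
  have "\<bar>c * f x - c * f y\<bar> = \<bar>c\<bar> * \<bar>f x - f y\<bar>" by (simp flip: right_diff_distrib abs_mult)
  also have "\<dots> \<le> (\<bar>c\<bar> + 1) * (\<bar>f x - f y\<bar> + \<bar>f x - f y\<bar>)" by (intro mult_mono) auto
  finally show "\<bar>c * f x - c * f y\<bar> \<le> (\<bar>c\<bar> + 1) * (\<bar>f x - f y\<bar> + \<bar>f x - f y\<bar>)" .
qed simp

lemma ac_on_bounded:
  assumes "ac_on a b f"
  obtains B where "B > 0" "\<And>x. x \<in> {a..b} \<Longrightarrow> \<bar>f x\<bar> \<le> B"
proof -
  have "continuous_on {a..b} f"
    unfolding continuous_on_iff
  proof (intro ballI allI impI)
    fix x e :: real assume x: "x \<in> {a..b}" and "e > 0"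
    obtain d where d: "d > 0" and D: "\<And>(I::unit set) l r. finite I \<Longrightarrow> (\<And>i. i \<in> I \<Longrightarrow> a \<le> l i \<and> l i \<le> r i \<and> r i \<le> b) \<Longrightarrow>
       (\<And>i j. i \<in> I \<Longrightarrow> j \<in> I \<Longrightarrow> i \<noteq> j \<Longrightarrow> {l i<..<r i} \<inter> {l j<..<r j} = {}) \<Longrightarrow>
       (\<Sum>i\<in>I. r i - l i) < d \<Longrightarrow> (\<Sum>i\<in>I. \<bar>f (l i) - f (r i)\<bar>) < e"
      by (rule ac_onD_finite_family[OF assms \<open>e > 0\<close>, where 'i = unit]) blast
    show "\<exists>d>0. \<forall>x'\<in>{a..b}. dist x' x < d \<longrightarrow> dist (f x') (f x) < e"
    proof (intro exI[of _ d] conjI d ballI impI)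
      fix y assume "y \<in> {a..b}" "dist y x < d"
      then have "\<bar>f (min x y) - f (max x y)\<bar> < e"
        using D[of UNIV "\<lambda>_. min x y" "\<lambda>_. max x y"] x by (simp add: dist_real_def UNIV_unit)
      then show "dist (f y) (f x) < e" by (cases "x \<le> y") (auto simp: dist_real_def min_def max_def)
    qed
  qed
  then have "bounded (f ` {a..b})"
    by (simp add: compact_continuous_image compact_imp_bounded)
  then obtain B where "B > 0" "\<forall>y\<in>f ` {a..b}. norm y \<le> B" by (auto simp: bounded_pos)
  then show ?thesis using that[of B] by auto
qed

lemma ac_on_mult:
  assumes f: "ac_on a b f" and g: "ac_on a b g" shows "ac_on a b (\<lambda>x. f x * g x)"
proof -
  obtain F where F: "F > 0" "\<And>x. x \<in> {a..b} \<Longrightarrow> \<bar>f x\<bar> \<le> F" using ac_on_bounded[OF f] by blast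
  obtain G where G: "G > 0" "\<And>x. x \<in> {a..b} \<Longrightarrow> \<bar>g x\<bar> \<le> G" using ac_on_bounded[OF g] by blast
  show ?thesis
  proof (rule abs_continuous_on_dominated[OF f g order_refl order_refl, of "F + G"])
    fix x y assume xy: "x \<in> {a..b}" "y \<in> {a..b}"
    have "\<bar>f x * g x - f y * g y\<bar> = \<bar>(f x - f y) * g x + f y * (g x - g y)\<bar>"
      by (simp add: algebra_simps)
    also have "\<dots> \<le> \<bar>f x - f y\<bar> * \<bar>g x\<bar> + \<bar>f y\<bar> * \<bar>g x - g y\<bar>"
      by (rule order_trans[OF abs_triangle_ineq]) (simp add: abs_mult)
    also have "\<dots> \<le> \<bar>f x - f y\<bar> * (F + G) + (F + G) * \<bar>g x - g y\<bar>"
      using F(1) G(1) F(2)[OF xy(2)] G(2)[OF xy(1)] by (intro add_mono mult_mono) auto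
    finally show "\<bar>f x * g x - f y * g y\<bar> \<le> (F + G) * (\<bar>f x - f y\<bar> + \<bar>g x - g y\<bar>)"
      by (simp add: algebra_simps)
  qed (use F G in simp)
qed

lemma ac_on_power: "ac_on a b f \<Longrightarrow> ac_on a b (\<lambda>x. f x ^ n)"
  by (induction n) (simp_all add: ac_on_const ac_on_mult)

lemma ac_on_sum:
  assumes "finite I" "\<And>i. i \<in> I \<Longrightarrow> ac_on a b (f i)" shows "ac_on a b (\<lambda>x. \<Sum>i\<in>I. f i x)"
  using assms by (induction I rule: finite_induct) (simp_all add: ac_on_const ac_on_add)

section \<open>Lower bounds for the Carnot--Caratheodory distance\<close>

lemma fst_le_euclid_dist: "\<bar>fst p - fst q\<bar> \<le> euclid_dist k p q"
  unfolding euclid_dist_def by (rule real_le_rsqrt) (simp add: sum_nonneg)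

lemma snd_le_euclid_dist:
  assumes "s \<le> k" shows "\<bar>snd p s - snd q s\<bar> \<le> euclid_dist k p q"
  unfolding euclid_dist_def
proof (rule real_le_rsqrt)
  have "(snd p s - snd q s)\<^sup>2 \<le> (\<Sum>s\<le>k. (snd p s - snd q s)\<^sup>2)"
    by (rule member_le_sum) (use assms in auto)
  then show "\<bar>snd p s - snd q s\<bar>\<^sup>2 \<le> (fst p - fst q)\<^sup>2 + (\<Sum>s\<le>k. (snd p s - snd q s)\<^sup>2)"
    unfolding power2_abs using zero_le_power2[of "fst p - fst q"] by linarith
qed

lemma horizontal_curve_ac:
  assumes "horizontal_curve k a b \<gamma>"
  shows "ac_on a b (\<lambda>\<tau>. fst (\<gamma> \<tau>))" and "s \<le> k \<Longrightarrow> ac_on a b (\<lambda>\<tau>. snd (\<gamma> \<tau>) s)"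
proof -
  have e: "abs_continuous_on (euclid_dist k) a b \<gamma>"
    using assms by (simp add: horizontal_curve_def)
  show "ac_on a b (\<lambda>\<tau>. fst (\<gamma> \<tau>))"
    by (rule abs_continuous_on_dominated[OF e e order_refl order_refl, of "1 / 2"]) (simp_all add: fst_le_euclid_dist)
  show "ac_on a b (\<lambda>\<tau>. snd (\<gamma> \<tau>) s)" if "s \<le> k"
    by (rule abs_continuous_on_dominated[OF e e order_refl order_refl, of "1 / 2"]) (simp_all add: snd_le_euclid_dist[OF that])
qed

lemma horizontal_curve_derivatives:
  fixes \<gamma> :: "real \<Rightarrow> jet"
  assumes "horizontal_curve k a b \<gamma>"
  defines "X \<equiv> \<lambda>\<tau>. deriv (\<lambda>r. fst (\<gamma> r)) \<tau>" and "U \<equiv> \<lambda>\<tau>. deriv (\<lambda>r. snd (\<gamma> r) k) \<tau>"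
  shows "AE \<tau> in lebesgue_on {a..b}.
     ((\<lambda>r. fst (\<gamma> r)) has_real_derivative X \<tau>) (at \<tau>) \<and>
     ((\<lambda>r. snd (\<gamma> r) k) has_real_derivative U \<tau>) (at \<tau>) \<and>
     (\<forall>s<k. ((\<lambda>r. snd (\<gamma> r) s) has_real_derivative X \<tau> * snd (\<gamma> \<tau>) (Suc s)) (at \<tau>))"
proof -
  have "AE \<tau> in lebesgue_on {a..b}. \<exists>v\<in>horizontal_space k (\<gamma> \<tau>). has_velocity \<gamma> v \<tau>"
    using assms(1) by (simp add: horizontal_curve_def)
  then show ?thesis
  proof (rule AE_mp, intro AE_I2 impI)
    fix \<tau> assume "\<exists>v\<in>horizontal_space k (\<gamma> \<tau>). has_velocity \<gamma> v \<tau>"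
    then obtain \<alpha> \<beta> where v: "has_velocity \<gamma> (frame_comb k (\<gamma> \<tau>) \<alpha> \<beta>) \<tau>"
      by (auto simp: horizontal_space_def)
    have x: "((\<lambda>r. fst (\<gamma> r)) has_real_derivative \<alpha>) (at \<tau>)"
      using v by (simp add: has_velocity_def frame_comb_def field_X_def field_U_def)
    have u: "((\<lambda>r. snd (\<gamma> r) s) has_real_derivative
        (\<alpha> * (if s < k then snd (\<gamma> \<tau>) (s + 1) else 0) + \<beta> * (if s = k then 1 else 0))) (at \<tau>)" for s
      using v by (simp add: has_velocity_def frame_comb_def field_X_def field_U_def)
    have "X \<tau> = \<alpha>" "U \<tau> = \<beta>"
      using DERIV_imp_deriv[OF x] DERIV_imp_deriv[OF u[of k]] by (simp_all add: X_def U_def)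
    moreover have "\<forall>s<k. ((\<lambda>r. snd (\<gamma> r) s) has_real_derivative \<alpha> * snd (\<gamma> \<tau>) (Suc s)) (at \<tau>)"
    proof (intro allI impI)
      fix s assume "s < k" then show "((\<lambda>r. snd (\<gamma> r) s) has_real_derivative \<alpha> * snd (\<gamma> \<tau>) (Suc s)) (at \<tau>)"
        using u[of s] by simp
    qed
    ultimately show "((\<lambda>r. fst (\<gamma> r)) has_real_derivative X \<tau>) (at \<tau>) \<and>
     ((\<lambda>r. snd (\<gamma> r) k) has_real_derivative U \<tau>) (at \<tau>) \<and>
     (\<forall>s<k. ((\<lambda>r. snd (\<gamma> r) s) has_real_derivative X \<tau> * snd (\<gamma> \<tau>) (Suc s)) (at \<tau>))"
      using x u[of k] by simp
  qed
qed

lemma curve_length_ge_x: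
  "(\<integral>\<^sup>+\<tau>. ennreal \<bar>deriv (\<lambda>r. fst (\<gamma> r)) \<tau>\<bar> \<partial>lebesgue_on {a..b}) \<le> curve_length k a b \<gamma>"
  unfolding curve_length_def
  by (intro nn_integral_mono ennreal_leI) (auto simp: horizontal_norm_def velocity_def intro!: real_le_rsqrt)

lemma curve_length_ge_u:
  "(\<integral>\<^sup>+\<tau>. ennreal \<bar>deriv (\<lambda>r. snd (\<gamma> r) k) \<tau>\<bar> \<partial>lebesgue_on {a..b}) \<le> curve_length k a b \<gamma>"
  unfolding curve_length_def
  by (intro nn_integral_mono ennreal_leI) (auto simp: horizontal_norm_def velocity_def intro!: real_le_rsqrt)

text \<open>
The length element dominates \<open>\<bar>x'\<bar>\<close>. Stating this for every time
\<open>\<tau>\<close> bounds the whole excursion of the curve from its initial fibre, as needed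
for the vertical estimate below.
\<close>

lemma x_increment_le_curve_length:
  assumes h: "horizontal_curve k a b \<gamma>" and \<tau>: "\<tau> \<in> {a..b}"
  shows "ennreal \<bar>fst (\<gamma> \<tau>) - fst (\<gamma> a)\<bar> \<le> curve_length k a b \<gamma>"
proof -
  let ?X = "\<lambda>\<tau>. deriv (\<lambda>r. fst (\<gamma> r)) \<tau>"
  have sub: "{a..\<tau>} \<subseteq> {a..b}" using \<tau> by auto
  have ae_ab: "AE s in lebesgue_on {a..b}. ((\<lambda>r. fst (\<gamma> r)) has_real_derivative ?X s) (at s)"
    using horizontal_curve_derivatives[OF h] by (rule AE_mp) (auto intro!: AE_I2)
  have ae: "AE s in lebesgue_on {a..\<tau>}. ((\<lambda>r. fst (\<gamma> r)) has_real_derivative ?X s) (at s)"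
  proof -
    have "AE s in lebesgue. s \<in> {a..b} \<longrightarrow> ((\<lambda>r. fst (\<gamma> r)) has_real_derivative ?X s) (at s)"
      using ae_ab by (simp add: AE_restrict_space_iff)
    then have "AE s in lebesgue. s \<in> {a..\<tau>} \<longrightarrow> ((\<lambda>r. fst (\<gamma> r)) has_real_derivative ?X s) (at s)"
      by (rule eventually_mono) (use sub in blast)
    then show ?thesis by (simp add: AE_restrict_space_iff)
  qed
  have ac: "ac_on a \<tau> (\<lambda>s. fst (\<gamma> s))"
    by (rule abs_continuous_on_dominated[OF horizontal_curve_ac(1)[OF h] horizontal_curve_ac(1)[OF h] order_refl, of _ "1 / 2"])
      (use \<tau> in auto)
  have "ennreal \<bar>fst (\<gamma> \<tau>) - fst (\<gamma> a)\<bar> \<le> (\<integral>\<^sup>+s. ennreal \<bar>?X s\<bar> \<partial>lebesgue_on {a..\<tau>})"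
    by (rule ac_increment_le_nn_integral(2)[OF _ ac ae]) (use \<tau> in auto)
  also have "\<dots> \<le> (\<integral>\<^sup>+s. ennreal \<bar>?X s\<bar> \<partial>lebesgue_on {a..b})"
    using sub by (simp add: nn_integral_restrict_space) (auto intro!: nn_integral_mono simp: indicator_def)
  also have "\<dots> \<le> curve_length k a b \<gamma>" by (rule curve_length_ge_x)
  finally show ?thesis .
qed

lemma fst_diff_le_d_cc: "ennreal \<bar>fst p - fst q\<bar> \<le> d_cc k p q"
  unfolding d_cc_def
proof (rule Inf_greatest, safe)
  fix a b \<gamma> assume "a \<le> b" "horizontal_curve k a b \<gamma>" "p = \<gamma> a" "q = \<gamma> b"
  then show "ennreal \<bar>fst (\<gamma> a) - fst (\<gamma> b)\<bar> \<le> curve_length k a b \<gamma>"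
    using x_increment_le_curve_length[of k a b \<gamma> b] by (simp add: abs_minus_commute)
qed

text \<open>
Along a horizontal curve with \<open>y = t - x\<close>, the Taylor polynomial at \<open>t\<close>
of the current jet varies only through the control \<open>u\<^sub>k' = \<beta>\<close>: the terms
coming from the motion in \<open>x\<close> telescope.
\<close>

lemma has_derivative_taylor_sum:
  fixes u :: "nat \<Rightarrow> real \<Rightarrow> real"
  assumes y: "(y has_real_derivative - \<alpha>) (at \<tau>)"
    and u: "\<And>s. s < n \<Longrightarrow> (u s has_real_derivative \<alpha> * u (Suc s) \<tau>) (at \<tau>)"
    and un: "(u n has_real_derivative \<beta>) (at \<tau>)"
  shows "((\<lambda>r. \<Sum>j\<le>n. u j r * y r ^ j / fact j) has_real_derivative \<beta> * y \<tau> ^ n / fact n) (at \<tau>)"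
  using u un
proof (induction n arbitrary: \<beta>)
  case 0
  then show ?case by simp
next
  case (Suc n)
  have 1: "((\<lambda>r. \<Sum>j\<le>n. u j r * y r ^ j / fact j) has_real_derivative \<alpha> * u (Suc n) \<tau> * y \<tau> ^ n / fact n) (at \<tau>)"
    by (rule Suc.IH) (use Suc.prems in auto)
  have 2: "((\<lambda>r. u (Suc n) r * y r ^ Suc n / fact (Suc n)) has_real_derivative
      (\<beta> * y \<tau> ^ Suc n + real (Suc n) * y \<tau> ^ n * (- \<alpha>) * u (Suc n) \<tau>) / fact (Suc n)) (at \<tau>)"
    using DERIV_cdivide[OF DERIV_mult[OF Suc.prems(2) DERIV_power[OF y, of "Suc n"]], of "fact (Suc n)"]
    by (simp add: algebra_simps)
  have "\<alpha> * u (Suc n) \<tau> * y \<tau> ^ n / fact n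
     + (\<beta> * y \<tau> ^ Suc n + real (Suc n) * y \<tau> ^ n * (- \<alpha>) * u (Suc n) \<tau>) / fact (Suc n)
     = \<beta> * y \<tau> ^ Suc n / fact (Suc n)"
    by (simp add: divide_simps)
  then show ?case using DERIV_add[OF 1 2] by simp
qed

text \<open>
By \<open>has_derivative_taylor_sum\<close>, the constant coefficient \<open>W\<close> of the jet
transported to the initial fibre \<open>x = t\<close> satisfies \<open>W' = u\<^sub>k' (t - x) ^ k
/ fact k\<close>, and it equals \<open>u\<^sub>0\<close> at both endpoints. A curve of length
\<open>L\<close> has \<open>\<bar>t - x\<bar> \<le> L\<close> throughout, and
\<open>\<bar>u\<^sub>k'\<bar>\<close> has integral at most \<open>L\<close>.
\<close>

lemma vertical_increment_le_curve_length:
  assumes ab: "a \<le> b" and h: "horizontal_curve k a b \<gamma>" and eq: "fst (\<gamma> b) = fst (\<gamma> a)"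
    and len: "curve_length k a b \<gamma> \<le> ennreal L" and L: "L \<ge> 0"
  shows "fact k * \<bar>snd (\<gamma> b) 0 - snd (\<gamma> a) 0\<bar> \<le> L ^ Suc k"
proof -
  define t where "t = fst (\<gamma> a)"
  define y where "y \<tau> = t - fst (\<gamma> \<tau>)" for \<tau>
  define W where "W = (\<lambda>\<tau>. \<Sum>j\<le>k. snd (\<gamma> \<tau>) j * y \<tau> ^ j / fact j)"
  define X where "X = (\<lambda>\<tau>. deriv (\<lambda>r. fst (\<gamma> r)) \<tau>)"
  define U where "U = (\<lambda>\<tau>. deriv (\<lambda>r. snd (\<gamma> r) k) \<tau>)"
  have y0: "y a = 0" "y b = 0" by (simp_all add: y_def t_def eq)
  have W0: "W \<tau> = snd (\<gamma> \<tau>) 0" if "y \<tau> = 0" for \<tau>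
  proof -
    have "W \<tau> = (\<Sum>j\<le>k. if j = 0 then snd (\<gamma> \<tau>) 0 else 0)"
      unfolding W_def by (rule sum.cong) (use that in auto)
    then show ?thesis by simp
  qed
  have yL: "\<bar>y \<tau>\<bar> \<le> L" if "\<tau> \<in> {a..b}" for \<tau>
    using order_trans[OF x_increment_le_curve_length[OF h that] len] L
    by (simp add: y_def t_def ennreal_le_iff abs_minus_commute)
  note der = horizontal_curve_derivatives[OF h, folded X_def U_def]
  have "AE \<tau> in lebesgue_on {a..b}. (W has_real_derivative U \<tau> * y \<tau> ^ k / fact k) (at \<tau>)"
    using der
  proof (rule AE_mp, intro AE_I2 impI, elim conjE)
    fix \<tau>
    assume x: "((\<lambda>r. fst (\<gamma> r)) has_real_derivative X \<tau>) (at \<tau>)"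
      and uk: "((\<lambda>r. snd (\<gamma> r) k) has_real_derivative U \<tau>) (at \<tau>)"
      and us: "\<forall>s<k. ((\<lambda>r. snd (\<gamma> r) s) has_real_derivative X \<tau> * snd (\<gamma> \<tau>) (Suc s)) (at \<tau>)"
    have "(y has_real_derivative - X \<tau>) (at \<tau>)"
      unfolding y_def using DERIV_diff[OF DERIV_const x] by simp
    then show "(W has_real_derivative U \<tau> * y \<tau> ^ k / fact k) (at \<tau>)"
      unfolding W_def by (rule has_derivative_taylor_sum) (use us uk in auto)
  qed
  moreover have "ac_on a b W"
  proof -
    have "ac_on a b y" unfolding y_def
      using ac_on_add[OF ac_on_const ac_on_cmult[OF horizontal_curve_ac(1)[OF h], of "-1"], of t] by simp
    then have "ac_on a b (\<lambda>\<tau>. (1 / fact j) * (snd (\<gamma> \<tau>) j * y \<tau> ^ j))" if "j \<le> k" for j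
      by (intro ac_on_cmult ac_on_mult ac_on_power horizontal_curve_ac(2)[OF h that])
    then show ?thesis unfolding W_def by (intro ac_on_sum) auto
  qed
  ultimately have "ennreal \<bar>W b - W a\<bar> \<le> (\<integral>\<^sup>+\<tau>. ennreal \<bar>U \<tau> * y \<tau> ^ k / fact k\<bar> \<partial>lebesgue_on {a..b})"
    by (intro ac_increment_le_nn_integral(2)[OF ab])
  also have "\<dots> \<le> (\<integral>\<^sup>+\<tau>. ennreal (L ^ k / fact k) * ennreal \<bar>U \<tau>\<bar> \<partial>lebesgue_on {a..b})"
  proof (rule nn_integral_mono)
    fix \<tau> assume "\<tau> \<in> space (lebesgue_on {a..b})"
    then have "\<bar>y \<tau>\<bar> ^ k \<le> L ^ k" using yL by (intro power_mono) auto
    then have "\<bar>U \<tau> * y \<tau> ^ k / fact k\<bar> \<le> (L ^ k / fact k) * \<bar>U \<tau>\<bar>"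
      by (simp add: abs_mult power_abs divide_simps mult.commute mult_left_mono)
    then show "ennreal \<bar>U \<tau> * y \<tau> ^ k / fact k\<bar> \<le> ennreal (L ^ k / fact k) * ennreal \<bar>U \<tau>\<bar>"
      using L by (simp flip: ennreal_mult add: ennreal_leI)
  qed
  also have "\<dots> = ennreal (L ^ k / fact k) * (\<integral>\<^sup>+\<tau>. ennreal \<bar>U \<tau>\<bar> \<partial>lebesgue_on {a..b})"
  proof (rule nn_integral_cmult)
    have "AE \<tau> in lebesgue_on {a..b}. ((\<lambda>r. snd (\<gamma> r) k) has_real_derivative U \<tau>) (at \<tau>)"
      using der by (rule AE_mp) (auto intro!: AE_I2)
    then have "U \<in> borel_measurable (lebesgue_on {a..b})"
      by (rule ac_increment_le_nn_integral(1)[OF ab horizontal_curve_ac(2)[OF h order_refl]])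
    then show "(\<lambda>\<tau>. ennreal \<bar>U \<tau>\<bar>) \<in> borel_measurable (lebesgue_on {a..b})" by measurable
  qed
  also have "\<dots> \<le> ennreal (L ^ k / fact k) * ennreal L"
    using order_trans[OF curve_length_ge_u len] unfolding U_def by (intro mult_left_mono) auto
  also have "\<dots> = ennreal (L ^ k / fact k * L)" using L by (simp flip: ennreal_mult)
  finally have "\<bar>W b - W a\<bar> \<le> L ^ k / fact k * L" using L by (simp add: ennreal_le_iff)
  then show ?thesis using y0 by (simp add: W0 divide_simps mult.commute)
qed

lemma vertical_diff_le_d_cc:
  assumes "fst p = fst q"
  shows "ennreal ((fact k * \<bar>snd p 0 - snd q 0\<bar>) powr (1 / real (k + 1))) \<le> d_cc k p q"
  unfolding d_cc_def
proof (rule Inf_greatest, safe)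
  fix a b \<gamma> assume ab: "a \<le> b" and h: "horizontal_curve k a b \<gamma>" and pq: "p = \<gamma> a" "q = \<gamma> b"
  show "ennreal ((fact k * \<bar>snd (\<gamma> a) 0 - snd (\<gamma> b) 0\<bar>) powr (1 / real (k + 1))) \<le> curve_length k a b \<gamma>"
  proof (cases "curve_length k a b \<gamma>")
    case (real L)
    have "fact k * \<bar>snd (\<gamma> b) 0 - snd (\<gamma> a) 0\<bar> \<le> L ^ Suc k"
      by (rule vertical_increment_le_curve_length[OF ab h]) (use real assms pq in auto)
    then have "(fact k * \<bar>snd (\<gamma> a) 0 - snd (\<gamma> b) 0\<bar>) powr (1 / real (k + 1)) \<le> (L ^ Suc k) powr (1 / real (k + 1))"
      by (intro powr_mono2) (auto simp: abs_minus_commute)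
    also have "\<dots> = L"
    proof (cases "L = 0")
      case False
      then have "L > 0" using real by simp
      then have "(L ^ Suc k) powr (1 / real (k + 1)) = L powr (real (Suc k) * (1 / real (k + 1)))"
        by (simp only: powr_realpow[symmetric] powr_powr)
      then show ?thesis using \<open>L > 0\<close> by simp
    qed simp
    finally show ?thesis using real by (simp add: ennreal_leI)
  qed simp
qed

section \<open>Explicit horizontal curves and upper bounds for the distance\<close>

text \<open>
A tame class of horizontal curves that is closed under concatenation: Lipschitz coordinates, at
most unit speed, and finitely many corners. Such curves are absolutely continuous, and the
parameter \<open>L\<close> bounds their length.
\<close>

definition joins :: "nat \<Rightarrow> jet \<Rightarrow> jet \<Rightarrow> real \<Rightarrow> bool" where
  "joins k p q L \<longleftrightarrow> 0 \<le> L \<and> (\<exists>\<gamma> A. \<gamma> 0 = p \<and> \<gamma> L = q \<and> (\<forall>\<tau>\<in>{0..L}. \<gamma> \<tau> \<in> jet_space k) \<and>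
     (\<exists>C. C-lipschitz_on {0..L} (\<lambda>\<tau>. fst (\<gamma> \<tau>))) \<and> (\<forall>s. \<exists>C. C-lipschitz_on {0..L} (\<lambda>\<tau>. snd (\<gamma> \<tau>) s)) \<and>
     finite A \<and>
     (\<forall>\<tau>\<in>{0..L} - A. \<exists>v\<in>horizontal_space k (\<gamma> \<tau>). has_velocity \<gamma> v \<tau> \<and> horizontal_norm k v \<le> 1))"

lemma sqrt_sum_squares_le: "sqrt (a\<^sup>2 + (\<Sum>s\<le>k. (b s)\<^sup>2)) \<le> \<bar>a\<bar> + (\<Sum>s\<le>(k::nat). \<bar>b s\<bar>)"
proof -
  have "sqrt (a\<^sup>2 + (\<Sum>s\<le>k. (b s)\<^sup>2)) \<le> sqrt (a\<^sup>2) + sqrt (\<Sum>s\<le>k. (b s)\<^sup>2)"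
    by (rule sqrt_add_le_add_sqrt) (auto intro: sum_nonneg)
  also have "sqrt (\<Sum>s\<le>k. (b s)\<^sup>2) \<le> (\<Sum>s\<le>k. \<bar>b s\<bar>)"
    using L2_set_le_sum_abs[of b "{..k}"] by (simp add: L2_set_def)
  finally show ?thesis by simp
qed

lemma d_cc_le_of_joins:
  assumes "joins k p q L" shows "d_cc k p q \<le> ennreal L"
proof -
  obtain \<gamma> A where L: "0 \<le> L" and ends: "\<gamma> 0 = p" "\<gamma> L = q"
    and js: "\<And>\<tau>. \<tau> \<in> {0..L} \<Longrightarrow> \<gamma> \<tau> \<in> jet_space k"
    and lf: "\<exists>C. C-lipschitz_on {0..L} (\<lambda>\<tau>. fst (\<gamma> \<tau>))" and ls: "\<And>s. \<exists>C. C-lipschitz_on {0..L} (\<lambda>\<tau>. snd (\<gamma> \<tau>) s)"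
    and A: "finite A"
    and v: "\<And>\<tau>. \<tau> \<in> {0..L} - A \<Longrightarrow> \<exists>v\<in>horizontal_space k (\<gamma> \<tau>). has_velocity \<gamma> v \<tau> \<and> horizontal_norm k v \<le> 1"
    using assms unfolding joins_def by blast
  obtain C0 where C0: "C0-lipschitz_on {0..L} (\<lambda>\<tau>. fst (\<gamma> \<tau>))" using lf by blast
  obtain C where C: "\<And>s. (C s)-lipschitz_on {0..L} (\<lambda>\<tau>. snd (\<gamma> \<tau>) s)" using ls by metis
  define B where "B = C0 + (\<Sum>s\<le>k. C s)"
  have B: "0 \<le> B" unfolding B_def
    using lipschitz_on_nonneg[OF C0] lipschitz_on_nonneg[OF C] by (intro add_nonneg_nonneg sum_nonneg)
  have dist: "euclid_dist k (\<gamma> x) (\<gamma> y) \<le> B * \<bar>x - y\<bar>" if "x \<in> {0..L}" "y \<in> {0..L}" for x y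
  proof -
    have "euclid_dist k (\<gamma> x) (\<gamma> y) \<le> \<bar>fst (\<gamma> x) - fst (\<gamma> y)\<bar> + (\<Sum>s\<le>k. \<bar>snd (\<gamma> x) s - snd (\<gamma> y) s\<bar>)"
      unfolding euclid_dist_def by (rule sqrt_sum_squares_le)
    also have "\<dots> \<le> C0 * \<bar>x - y\<bar> + (\<Sum>s\<le>k. C s * \<bar>x - y\<bar>)"
      using lipschitz_onD[OF C0 that] lipschitz_onD[OF C that]
      by (intro add_mono sum_mono) (auto simp: dist_real_def)
    finally show ?thesis by (simp add: B_def distrib_right sum_distrib_right)
  qed
  have ac: "abs_continuous_on (euclid_dist k) 0 L \<gamma>"
    unfolding abs_continuous_on_def
  proof (intro allI impI)
    fix e :: real assume e: "e > 0"
    show "\<exists>\<delta>>0. \<forall>(n::nat) l r. (\<forall>i<n. 0 \<le> l i \<and> l i \<le> r i \<and> r i \<le> L) \<longrightarrow>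
        (\<forall>i<n. \<forall>j<n. i \<noteq> j \<longrightarrow> {l i<..<r i} \<inter> {l j<..<r j} = {}) \<longrightarrow>
        (\<Sum>i<n. r i - l i) < \<delta> \<longrightarrow> (\<Sum>i<n. euclid_dist k (\<gamma> (l i)) (\<gamma> (r i))) < e"
    proof (intro exI[of _ "e / (B + 1)"] conjI allI impI)
      show "e / (B + 1) > 0" using e B by simp
      fix n :: nat and l r :: "nat \<Rightarrow> real"
      assume lr: "\<forall>i<n. 0 \<le> l i \<and> l i \<le> r i \<and> r i \<le> L" and s: "(\<Sum>i<n. r i - l i) < e / (B + 1)"
      have nn: "0 \<le> (\<Sum>i<n. r i - l i)" using lr by (intro sum_nonneg) auto
      have "(\<Sum>i<n. euclid_dist k (\<gamma> (l i)) (\<gamma> (r i))) \<le> (\<Sum>i<n. B * (r i - l i))"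
      proof (rule sum_mono)
        fix i assume "i \<in> {..<n}"
        then have i: "0 \<le> l i" "l i \<le> r i" "r i \<le> L" using lr by auto
        then show "euclid_dist k (\<gamma> (l i)) (\<gamma> (r i)) \<le> B * (r i - l i)"
          using dist[of "l i" "r i"] by simp
      qed
      also have "\<dots> = B * (\<Sum>i<n. r i - l i)" by (simp add: sum_distrib_left)
      also have "\<dots> \<le> (B + 1) * (\<Sum>i<n. r i - l i)" using nn by (intro mult_right_mono) auto
      also have "\<dots> < e" using s B by (simp add: field_simps)
      finally show "(\<Sum>i<n. euclid_dist k (\<gamma> (l i)) (\<gamma> (r i))) < e" .
    qed
  qed
  have "A \<in> null_sets lebesgue" using A finite_imp_null_set_lborel[OF A] by (simp add: null_sets_completionI)
  then have "AE \<tau> in lebesgue. \<tau> \<notin> A" by (rule AE_not_in)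
  then have ae: "AE \<tau> in lebesgue_on {0..L}. \<tau> \<in> {0..L} - A"
    by (simp add: AE_restrict_space_iff) (auto elim: eventually_mono)
  have "AE \<tau> in lebesgue_on {0..L}. \<exists>v\<in>horizontal_space k (\<gamma> \<tau>). has_velocity \<gamma> v \<tau>"
    using ae by (rule eventually_mono) (use v in blast)
  then have h: "horizontal_curve k 0 L \<gamma>" using js ac by (simp add: horizontal_curve_def)
  have "curve_length k 0 L \<gamma> \<le> (\<integral>\<^sup>+\<tau>. 1 \<partial>lebesgue_on {0..L})"
    unfolding curve_length_def
  proof (rule nn_integral_mono_AE, rule eventually_mono[OF ae])
    fix \<tau> assume "\<tau> \<in> {0..L} - A"
    then obtain w where w: "has_velocity \<gamma> w \<tau>" "horizontal_norm k w \<le> 1" using v by blast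
    then have "velocity \<gamma> \<tau> = w"
      unfolding velocity_def has_velocity_def by (auto simp: prod_eq_iff fun_eq_iff intro: DERIV_imp_deriv)
    then show "ennreal (horizontal_norm k (velocity \<gamma> \<tau>)) \<le> 1" using w by simp
  qed
  also have "\<dots> = ennreal L" using L by (simp add: emeasure_restrict_space)
  finally have "curve_length k 0 L \<gamma> \<le> ennreal L" .
  moreover have "d_cc k p q \<le> curve_length k 0 L \<gamma>"
    unfolding d_cc_def using L h ends by (intro Inf_lower) blast
  ultimately show ?thesis by (rule order_trans[rotated])
qed

lemma has_velocity_cong:
  assumes "eventually (\<lambda>r. \<gamma> r = \<gamma>' r) (nhds \<tau>)"
  shows "has_velocity \<gamma> v \<tau> \<longleftrightarrow> has_velocity \<gamma>' v \<tau>"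
proof -
  have "((\<lambda>r. fst (\<gamma> r)) has_real_derivative d) (at \<tau>) \<longleftrightarrow> ((\<lambda>r. fst (\<gamma>' r)) has_real_derivative d) (at \<tau>)" for d
    by (rule DERIV_cong_ev[OF refl _ refl]) (use assms in \<open>auto elim: eventually_mono\<close>)
  moreover have "((\<lambda>r. snd (\<gamma> r) s) has_real_derivative d) (at \<tau>) \<longleftrightarrow> ((\<lambda>r. snd (\<gamma>' r) s) has_real_derivative d) (at \<tau>)" for d s
    by (rule DERIV_cong_ev[OF refl _ refl]) (use assms in \<open>auto elim: eventually_mono\<close>)
  ultimately show ?thesis by (simp add: has_velocity_def)
qed

lemma lipschitz_on_join:
  fixes f g :: "real \<Rightarrow> real"
  assumes "\<exists>C. C-lipschitz_on {0..L} f" "\<exists>C. C-lipschitz_on {0..M} g" "f L = g 0"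
  shows "\<exists>C. C-lipschitz_on {0..L + M} (\<lambda>\<tau>. if \<tau> \<le> L then f \<tau> else g (\<tau> - L))"
proof -
  obtain C where C: "C-lipschitz_on {0..L} f" using assms by blast
  obtain D where D: "D-lipschitz_on {0..M} g" using assms by blast
  have "D-lipschitz_on {L..L + M} (\<lambda>\<tau>. g (\<tau> - L))"
  proof (rule lipschitz_onI)
    fix x y assume "x \<in> {L..L + M}" "y \<in> {L..L + M}"
    then show "dist (g (x - L)) (g (y - L)) \<le> D * dist x y"
      using lipschitz_onD[OF D, of "x - L" "y - L"] by (auto simp: dist_real_def)
  qed (rule lipschitz_on_nonneg[OF D])
  then have D': "(max C D)-lipschitz_on {L..L + M} (\<lambda>\<tau>. g (\<tau> - L))"
    by (rule lipschitz_on_le) simp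
  have "(max C D)-lipschitz_on {0..L + M} (\<lambda>\<tau>. if \<tau> \<le> L then f \<tau> else g (\<tau> - L))"
    by (rule lipschitz_on_concat[OF lipschitz_on_le[OF C] D']) (use assms(3) in auto)
  then show ?thesis by blast
qed

lemma joins_trans:
  assumes "joins k p q L" "joins k q r M" shows "joins k p r (L + M)"
proof -
  obtain \<gamma>1 A1 where L: "0 \<le> L" and e1: "\<gamma>1 0 = p" "\<gamma>1 L = q"
    and js1: "\<And>\<tau>. \<tau> \<in> {0..L} \<Longrightarrow> \<gamma>1 \<tau> \<in> jet_space k"
    and lf1: "\<exists>C. C-lipschitz_on {0..L} (\<lambda>\<tau>. fst (\<gamma>1 \<tau>))" and ls1: "\<And>s. \<exists>C. C-lipschitz_on {0..L} (\<lambda>\<tau>. snd (\<gamma>1 \<tau>) s)"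
    and A1: "finite A1"
    and v1: "\<And>\<tau>. \<tau> \<in> {0..L} - A1 \<Longrightarrow> \<exists>v\<in>horizontal_space k (\<gamma>1 \<tau>). has_velocity \<gamma>1 v \<tau> \<and> horizontal_norm k v \<le> 1"
    using assms(1) unfolding joins_def by blast
  obtain \<gamma>2 A2 where M: "0 \<le> M" and e2: "\<gamma>2 0 = q" "\<gamma>2 M = r"
    and js2: "\<And>\<tau>. \<tau> \<in> {0..M} \<Longrightarrow> \<gamma>2 \<tau> \<in> jet_space k"
    and lf2: "\<exists>C. C-lipschitz_on {0..M} (\<lambda>\<tau>. fst (\<gamma>2 \<tau>))" and ls2: "\<And>s. \<exists>C. C-lipschitz_on {0..M} (\<lambda>\<tau>. snd (\<gamma>2 \<tau>) s)"
    and A2: "finite A2"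
    and v2: "\<And>\<tau>. \<tau> \<in> {0..M} - A2 \<Longrightarrow> \<exists>v\<in>horizontal_space k (\<gamma>2 \<tau>). has_velocity \<gamma>2 v \<tau> \<and> horizontal_norm k v \<le> 1"
    using assms(2) unfolding joins_def by blast
  define \<gamma> where "\<gamma> \<tau> = (if \<tau> \<le> L then \<gamma>1 \<tau> else \<gamma>2 (\<tau> - L))" for \<tau>
  define A where "A = insert L (A1 \<union> (\<lambda>x. x + L) ` A2)"
  have vel: "\<exists>v\<in>horizontal_space k (\<gamma> \<tau>). has_velocity \<gamma> v \<tau> \<and> horizontal_norm k v \<le> 1"
    if \<tau>: "\<tau> \<in> {0..L + M} - A" for \<tau>
  proof (cases "\<tau> < L")
    case True
    have "eventually (\<lambda>r. r \<in> {..<L}) (nhds \<tau>)" by (rule eventually_nhds_in_open) (use True in auto)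
    then have "eventually (\<lambda>r. \<gamma> r = \<gamma>1 r) (nhds \<tau>)" by (rule eventually_mono) (simp add: \<gamma>_def)
    moreover have "\<tau> \<in> {0..L} - A1" using \<tau> True by (auto simp: A_def)
    moreover have "\<gamma> \<tau> = \<gamma>1 \<tau>" using True by (simp add: \<gamma>_def)
    ultimately show ?thesis using v1[of \<tau>] has_velocity_cong by metis
  next
    case False
    then have gt: "L < \<tau>" using \<tau> by (auto simp: A_def)
    have "eventually (\<lambda>r. r \<in> {L<..}) (nhds \<tau>)" by (rule eventually_nhds_in_open) (use gt in auto)
    then have ev: "eventually (\<lambda>r. \<gamma> r = \<gamma>2 (r - L)) (nhds \<tau>)" by (rule eventually_mono) (simp add: \<gamma>_def)
    have "\<tau> - L \<in> {0..M} - A2"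
    proof -
      have "\<tau> - L \<notin> A2"
      proof
        assume "\<tau> - L \<in> A2"
        then have "\<tau> \<in> (\<lambda>x. x + L) ` A2" by (intro image_eqI[of _ _ "\<tau> - L"]) auto
        then show False using \<tau> by (simp add: A_def)
      qed
      then show ?thesis using \<tau> gt by auto
    qed
    then obtain v where v: "v \<in> horizontal_space k (\<gamma>2 (\<tau> - L))" "has_velocity \<gamma>2 v (\<tau> - L)" "horizontal_norm k v \<le> 1"
      using v2 by blast
    have "has_velocity (\<lambda>r. \<gamma>2 (r - L)) v \<tau>"
      using v(2) DERIV_shift[of _ _ \<tau> "- L"] unfolding has_velocity_def by simp
    then have "has_velocity \<gamma> v \<tau>" using has_velocity_cong[OF ev] by simp
    moreover have "\<gamma> \<tau> = \<gamma>2 (\<tau> - L)" using gt by (simp add: \<gamma>_def)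
    ultimately show ?thesis using v by auto
  qed
  show ?thesis
    unfolding joins_def
  proof (intro conjI exI[of _ \<gamma>] exI[of _ A] allI ballI)
    show "0 \<le> L + M" using L M by simp
    show "\<gamma> 0 = p" using L e1 by (simp add: \<gamma>_def)
    show "\<gamma> (L + M) = r" using M e1 e2 by (cases "M = 0") (auto simp: \<gamma>_def)
    show "\<gamma> \<tau> \<in> jet_space k" if "\<tau> \<in> {0..L + M}" for \<tau>
      using that js1[of \<tau>] js2[of "\<tau> - L"] by (auto simp: \<gamma>_def)
    show "\<exists>C. C-lipschitz_on {0..L + M} (\<lambda>\<tau>. fst (\<gamma> \<tau>))"
      using lipschitz_on_join[OF lf1 lf2] e1 e2 by (simp add: \<gamma>_def if_distrib[of fst])
    show "\<exists>C. C-lipschitz_on {0..L + M} (\<lambda>\<tau>. snd (\<gamma> \<tau>) s)" for s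
      using lipschitz_on_join[OF ls1[of s] ls2[of s]] e1 e2 by (simp add: \<gamma>_def if_distrib[of "\<lambda>p. snd p s"])
    show "finite A" using A1 A2 by (simp add: A_def)
  qed (rule vel)
qed

text \<open>
Coordinates of a curve driven by constant controls have continuous derivatives, because each
derivative is a multiple of the next coordinate, hence they are Lipschitz on compact intervals.
\<close>

lemma joins_of_constant_controls:
  assumes L: "0 \<le> L" and js: "\<And>\<tau>. \<gamma> \<tau> \<in> jet_space k"
    and vel: "\<And>\<tau>. has_velocity \<gamma> (frame_comb k (\<gamma> \<tau>) \<alpha> \<beta>) \<tau>" and ab: "\<alpha>\<^sup>2 + \<beta>\<^sup>2 \<le> 1"
  shows "joins k (\<gamma> 0) (\<gamma> L) L"
proof -
  have lip: "\<exists>C. C-lipschitz_on {0..L} f"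
    if f: "\<And>\<tau>. (f has_real_derivative f' \<tau>) (at \<tau>)" and f': "continuous_on {0..L} f'" for f f' :: "real \<Rightarrow> real"
  proof -
    have "bounded (f' ` {0..L})" using f' by (simp add: compact_continuous_image compact_imp_bounded)
    then obtain C where C: "C > 0" "\<And>\<tau>. \<tau> \<in> {0..L} \<Longrightarrow> \<bar>f' \<tau>\<bar> \<le> C" by (auto simp: bounded_pos)
    have "C-lipschitz_on {0..L} f"
    proof (rule lipschitz_onI)
      fix x y assume "x \<in> {0..L}" "y \<in> {0..L}"
      then show "dist (f x) (f y) \<le> C * dist x y"
        using field_differentiable_bound[of "{0..L}" f f' C x y] C f
        by (simp add: dist_norm has_field_derivative_at_within norm_minus_commute)
    qed (use C in simp)
    then show ?thesis by blast
  qed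
  have x: "((\<lambda>r. fst (\<gamma> r)) has_real_derivative \<alpha>) (at \<tau>)" for \<tau>
    using vel[of \<tau>] by (simp add: has_velocity_def frame_comb_def field_X_def field_U_def)
  have u: "((\<lambda>r. snd (\<gamma> r) s) has_real_derivative
        (\<alpha> * (if s < k then snd (\<gamma> \<tau>) (s + 1) else 0) + \<beta> * (if s = k then 1 else 0))) (at \<tau>)" for s \<tau>
    using vel[of \<tau>] by (simp add: has_velocity_def frame_comb_def field_X_def field_U_def)
  have cont: "continuous_on {0..L} (\<lambda>\<tau>. snd (\<gamma> \<tau>) s)" for s
    using u by (intro continuous_at_imp_continuous_on) (blast intro: DERIV_isCont)
  show ?thesis
    unfolding joins_def
  proof (intro conjI exI[of _ \<gamma>] exI[of _ "{}"] allI ballI L js refl)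
    show "\<exists>C. C-lipschitz_on {0..L} (\<lambda>\<tau>. fst (\<gamma> \<tau>))" by (rule lip[OF x]) simp
    show "\<exists>C. C-lipschitz_on {0..L} (\<lambda>\<tau>. snd (\<gamma> \<tau>) s)" for s
      by (rule lip[OF u]) (cases "s < k"; simp; intro continuous_intros cont)
    show "\<exists>v\<in>horizontal_space k (\<gamma> \<tau>). has_velocity \<gamma> v \<tau> \<and> horizontal_norm k v \<le> 1" for \<tau>
      using vel ab by (intro bexI[of _ "frame_comb k (\<gamma> \<tau>) \<alpha> \<beta>"])
        (auto simp: horizontal_norm_frame_comb horizontal_space_def)
  qed simp
qed

lemma joins_refl: "p \<in> jet_space k \<Longrightarrow> joins k p p 0"
  unfolding joins_def
  by (intro conjI exI[of _ "\<lambda>_. p"] exI[of _ "{0}"]) (auto intro: lipschitz_on_singleton[of 0])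

lemma joins_vertical:
  assumes "(x, u) \<in> jet_space k"
  shows "joins k (x, u) (x, u(k := u k + c)) \<bar>c\<bar>"
proof -
  define \<gamma> where "\<gamma> \<tau> = (x, u(k := u k + sgn c * \<tau>))" for \<tau>
  have "joins k (\<gamma> 0) (\<gamma> \<bar>c\<bar>) \<bar>c\<bar>"
  proof (rule joins_of_constant_controls[where \<alpha> = 0 and \<beta> = "sgn c"])
    show "\<gamma> \<tau> \<in> jet_space k" for \<tau> using assms by (simp add: \<gamma>_def jet_space_def)
    show "has_velocity \<gamma> (frame_comb k (\<gamma> \<tau>) 0 (sgn c)) \<tau>" for \<tau>
      unfolding has_velocity_def
    proof (intro conjI allI)
      show "((\<lambda>r. snd (\<gamma> r) s) has_real_derivative snd (frame_comb k (\<gamma> \<tau>) 0 (sgn c)) s) (at \<tau>)" for s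
        by (cases "s = k") (auto simp: \<gamma>_def frame_comb_def field_X_def field_U_def intro!: derivative_eq_intros)
    qed (simp add: \<gamma>_def frame_comb_def field_X_def field_U_def)
  qed (auto simp: sgn_if)
  then show ?thesis by (simp add: \<gamma>_def mult_sgn_abs)
qed

text \<open>
The jet at \<open>x\<close> of the polynomial with Taylor coefficients \<open>W\<close> at
\<open>t\<close>. In the coordinates \<open>W\<close>, which transport every jet to the fibre over
\<open>t\<close>, motion along \<open>field_X\<close> leaves \<open>W\<close> fixed.
\<close>

definition poly_jet :: "nat \<Rightarrow> real \<Rightarrow> (nat \<Rightarrow> real) \<Rightarrow> real \<Rightarrow> jet" where
  "poly_jet k t W x = (x, \<lambda>s. if s \<le> k then \<Sum>i\<le>k - s. W (s + i) * ((x - t) ^ i / fact i) else 0)"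

lemma poly_jet_in_jet_space: "poly_jet k t W x \<in> jet_space k"
  by (simp add: poly_jet_def jet_space_def)

lemma poly_jet_base: "poly_jet k t W t = (t, \<lambda>s. if s \<le> k then W s else 0)"
proof -
  have "(\<Sum>i\<le>n. W (s + i) * ((t - t) ^ i / fact i)) = W s" for n s
  proof -
    have "(\<Sum>i\<le>n. W (s + i) * ((t - t) ^ i / fact i)) = (\<Sum>i\<le>n. if i = 0 then W s else 0)"
      by (rule sum.cong) auto
    then show ?thesis by simp
  qed
  then show ?thesis by (simp add: poly_jet_def fun_eq_iff)
qed

lemma has_derivative_exponential_sum:
  fixes a :: "nat \<Rightarrow> real"
  assumes "(y has_real_derivative \<alpha>) (at \<tau>)"
  shows "((\<lambda>r. \<Sum>i\<le>Suc n. a i * (y r ^ i / fact i)) has_real_derivative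
     \<alpha> * (\<Sum>i\<le>n. a (Suc i) * (y \<tau> ^ i / fact i))) (at \<tau>)"
proof -
  have d: "((\<lambda>r. a i * (y r ^ i / fact i)) has_real_derivative a i * (real i * (\<alpha> * y \<tau> ^ (i - 1)) / fact i)) (at \<tau>)" for i
    using DERIV_cmult[OF DERIV_cdivide[OF DERIV_power[OF assms, of i], of "fact i"], of "a i"] by simp
  have "((\<lambda>r. \<Sum>i\<le>Suc n. a i * (y r ^ i / fact i)) has_real_derivative
     (\<Sum>i\<le>Suc n. a i * (real i * (\<alpha> * y \<tau> ^ (i - 1)) / fact i))) (at \<tau>)"
    by (rule DERIV_sum) (rule d)
  also have "(\<Sum>i\<le>Suc n. a i * (real i * (\<alpha> * y \<tau> ^ (i - 1)) / fact i))
     = (\<Sum>i\<le>n. a (Suc i) * (real (Suc i) * (\<alpha> * y \<tau> ^ i) / fact (Suc i)))"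
    by (subst sum.atMost_Suc_shift) simp
  also have "\<dots> = \<alpha> * (\<Sum>i\<le>n. a (Suc i) * (y \<tau> ^ i / fact i))"
    unfolding sum_distrib_left by (rule sum.cong) (simp_all add: divide_simps)
  finally show ?thesis .
qed

lemma joins_along_poly_jet: "joins k (poly_jet k t W x) (poly_jet k t W x') \<bar>x' - x\<bar>"
proof -
  define \<sigma> where "\<sigma> = sgn (x' - x)"
  define \<gamma> where "\<gamma> \<tau> = poly_jet k t W (x + \<sigma> * \<tau>)" for \<tau>
  have "joins k (\<gamma> 0) (\<gamma> \<bar>x' - x\<bar>) \<bar>x' - x\<bar>"
  proof (rule joins_of_constant_controls[where \<alpha> = \<sigma> and \<beta> = 0])
    show "\<gamma> \<tau> \<in> jet_space k" for \<tau> by (simp add: \<gamma>_def poly_jet_in_jet_space)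
    show "has_velocity \<gamma> (frame_comb k (\<gamma> \<tau>) \<sigma> 0) \<tau>" for \<tau>
      unfolding has_velocity_def
    proof (intro conjI allI)
      show "((\<lambda>r. fst (\<gamma> r)) has_real_derivative fst (frame_comb k (\<gamma> \<tau>) \<sigma> 0)) (at \<tau>)"
        by (auto simp: \<gamma>_def poly_jet_def frame_comb_def field_X_def field_U_def intro!: derivative_eq_intros)
      have y: "((\<lambda>r. x + \<sigma> * r - t) has_real_derivative \<sigma>) (at \<tau>)" by (auto intro!: derivative_eq_intros)
      show "((\<lambda>r. snd (\<gamma> r) s) has_real_derivative snd (frame_comb k (\<gamma> \<tau>) \<sigma> 0) s) (at \<tau>)" for s
      proof (cases "s < k")
        case True
        then have n: "k - s = Suc (k - Suc s)" by simp
        show ?thesis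
          using has_derivative_exponential_sum[OF y, of "\<lambda>i. W (s + i)" "k - Suc s"] True
          unfolding n[symmetric] by (simp add: \<gamma>_def poly_jet_def frame_comb_def field_X_def field_U_def)
      next
        case False
        then show ?thesis
          by (cases "s = k") (simp_all add: \<gamma>_def poly_jet_def frame_comb_def field_X_def field_U_def)
      qed
    qed
  qed (auto simp: \<sigma>_def sgn_if)
  then show ?thesis by (simp add: \<gamma>_def \<sigma>_def mult_sgn_abs)
qed

text \<open>
The binomial theorem as the product rule for exponential series.
\<close>

lemma exponential_binomial:
  fixes a b :: real
  shows "(\<Sum>i\<le>n. a ^ (n - i) / fact (n - i) * (b ^ i / fact i)) = (a + b) ^ n / fact n"
proof -
  have "(a + b) ^ n / fact n = (b + a) ^ n / fact n" by (simp add: add.commute)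
  also have "\<dots> = (\<Sum>i\<le>n. of_nat (n choose i) * b ^ i * a ^ (n - i) / fact n)"
    unfolding binomial_ring sum_divide_distrib ..
  also have "\<dots> = (\<Sum>i\<le>n. a ^ (n - i) / fact (n - i) * (b ^ i / fact i))"
    by (rule sum.cong) (auto simp: binomial_fact divide_simps)
  finally show ?thesis by simp
qed

text \<open>
Raising \<open>u\<^sub>k\<close> by \<open>c\<close> at position \<open>x\<close> adds to the
polynomial \<open>c\<close> times the \<open>k\<close>-th divided power of the distance to
\<open>x\<close>, whose Taylor coefficients at \<open>t\<close> are divided powers of \<open>t -
x\<close>.
\<close>

lemma poly_jet_vertical_shift:
  assumes "poly_jet k t W x = (x, u)"
  shows "poly_jet k t (\<lambda>s. W s + c * ((t - x) ^ (k - s) / fact (k - s))) x = (x, u(k := u k + c))"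
proof -
  have u: "u s = (if s \<le> k then \<Sum>i\<le>k - s. W (s + i) * ((x - t) ^ i / fact i) else 0)" for s
    using assms by (auto simp: poly_jet_def)
  have "(\<Sum>i\<le>k - s. (W (s + i) + c * ((t - x) ^ (k - (s + i)) / fact (k - (s + i)))) * ((x - t) ^ i / fact i))
      = (\<Sum>i\<le>k - s. W (s + i) * ((x - t) ^ i / fact i)) + (if s = k then c else 0)" if "s \<le> k" for s
  proof -
    have "(\<Sum>i\<le>k - s. (t - x) ^ (k - s - i) / fact (k - s - i) * ((x - t) ^ i / fact i)) = 0 ^ (k - s) / fact (k - s)"
      using exponential_binomial[of "t - x" "k - s" "x - t"] by simp
    also have "\<dots> = (if s = k then 1 else 0)" using that by auto
    finally have "c * (\<Sum>i\<le>k - s. (t - x) ^ (k - s - i) / fact (k - s - i) * ((x - t) ^ i / fact i)) = (if s = k then c else 0)"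
      by simp
    then show ?thesis
      by (simp only: diff_diff_left distrib_right sum.distrib sum_distrib_left mult.assoc)
  qed
  then show ?thesis by (auto simp: poly_jet_def u fun_eq_iff)
qed

text \<open>
Leave the fibre over \<open>t\<close> along the polynomial jet, change \<open>u\<^sub>k\<close> at
distance \<open>h\<close>, and return.
\<close>

lemma joins_loop:
  "joins k (poly_jet k t W t) (poly_jet k t (\<lambda>s. W s + c * ((- h) ^ (k - s) / fact (k - s))) t) (2 * \<bar>h\<bar> + \<bar>c\<bar>)"
proof -
  let ?W' = "\<lambda>s. W s + c * ((- h) ^ (k - s) / fact (k - s))"
  obtain u where u: "poly_jet k t W (t + h) = (t + h, u)" by (simp add: poly_jet_def)
  have "joins k (poly_jet k t W t) (poly_jet k t W (t + h)) \<bar>h\<bar>"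
    using joins_along_poly_jet[of k t W t "t + h"] by simp
  moreover have "joins k (poly_jet k t W (t + h)) (poly_jet k t ?W' (t + h)) \<bar>c\<bar>"
    using joins_vertical[of "t + h" u k c] poly_jet_vertical_shift[OF u, of c] poly_jet_in_jet_space[of k t W "t + h"] u
    by simp
  moreover have "joins k (poly_jet k t ?W' (t + h)) (poly_jet k t ?W' t) \<bar>h\<bar>"
    using joins_along_poly_jet[of k t ?W' "t + h" t] by simp
  ultimately have "joins k (poly_jet k t W t) (poly_jet k t ?W' t) (\<bar>h\<bar> + \<bar>c\<bar> + \<bar>h\<bar>)"
    by (blast intro: joins_trans)
  then show ?thesis by (simp add: algebra_simps)
qed

lemma joins_loops:
  fixes c h :: "nat \<Rightarrow> real"
  shows "joins k (poly_jet k t W t) (poly_jet k t (\<lambda>s. W s + (\<Sum>i<n. c i * ((- h i) ^ (k - s) / fact (k - s)))) t)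
     (\<Sum>i<n. 2 * \<bar>h i\<bar> + \<bar>c i\<bar>)"
proof (induction n)
  case 0
  show ?case by (simp add: joins_refl poly_jet_in_jet_space)
next
  case (Suc n)
  show ?case
    using joins_trans[OF Suc.IH joins_loop[of k t _ "c n" "h n"]] by (simp add: add.assoc)
qed

text \<open>
The inverse of a Vandermonde matrix: the weights \<open>a n i\<close> are the \<open>n\<close>-th
coefficients of the Lagrange basis polynomials at the nodes \<open>0, \<dots>, k\<close>, because
interpolation reproduces \<open>x ^ m\<close> for \<open>m \<le> k\<close>.
\<close>

lemma exists_interpolation_weights:
  "\<exists>a :: nat \<Rightarrow> nat \<Rightarrow> real. \<forall>m\<le>k. \<forall>n\<le>k. (\<Sum>i\<le>k. real i ^ m * a n i) = (if m = n then 1 else 0)"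
proof -
  define l :: "nat \<Rightarrow> real poly" where
    "l i = (\<Prod>j\<in>{..k} - {i}. smult (1 / (real i - real j)) [:- real j, 1:])" for i
  have deg: "degree (l i) \<le> k" if "i \<le> k" for i
  proof -
    have "degree (l i) \<le> (\<Sum>j\<in>{..k} - {i}. degree (smult (1 / (real i - real j)) [:- real j, 1:]))"
      unfolding l_def by (rule order_trans[OF degree_prod_sum_le]) (simp_all add: o_def)
    also have "\<dots> \<le> (\<Sum>j\<in>{..k} - {i}. 1)" by (intro sum_mono) auto
    also have "\<dots> = k" using that by simp
    finally show ?thesis .
  qed
  have val: "poly (l i) (real x) = (if x = i then 1 else 0)" if "i \<le> k" "x \<le> k" for i x
  proof (cases "x = i")
    case True
    then show ?thesis
      by (auto simp: l_def poly_prod diff_divide_distrib[symmetric] intro!: prod.neutral)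
  next
    case False
    then show ?thesis using that by (auto simp: l_def poly_prod intro!: prod_zero)
  qed
  have interp: "(\<Sum>i\<le>k. smult (real i ^ m) (l i)) = monom 1 m" if m: "m \<le> k" for m
  proof (rule poly_eqI_degree)
    show "poly (\<Sum>i\<le>k. smult (real i ^ m) (l i)) x = poly (monom 1 m) x" if "x \<in> real ` {..k}" for x
    proof -
      obtain z where z: "z \<le> k" "x = real z" using \<open>x \<in> real ` {..k}\<close> by auto
      have "poly (\<Sum>i\<le>k. smult (real i ^ m) (l i)) x = (\<Sum>i\<le>k. if i = z then real z ^ m else 0)"
        unfolding poly_sum z(2) by (rule sum.cong) (use z val in auto)
      also have "\<dots> = real z ^ m" using z by simp
      finally show ?thesis by (simp add: z poly_monom)
    qed
    have "degree (\<Sum>i\<le>k. smult (real i ^ m) (l i)) \<le> k"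
      by (intro degree_sum_le) (auto simp: deg)
    then show "degree (\<Sum>i\<le>k. smult (real i ^ m) (l i)) < card (real ` {..k})"
      by (simp add: card_image inj_on_def)
    show "degree (monom (1::real) m) < card (real ` {..k})"
      using m by (simp add: card_image inj_on_def degree_monom_eq)
  qed
  have "(\<Sum>i\<le>k. real i ^ m * coeff (l i) n) = (if m = n then 1 else 0)" if "m \<le> k" for m n
  proof -
    have "(\<Sum>i\<le>k. real i ^ m * coeff (l i) n) = coeff (\<Sum>i\<le>k. smult (real i ^ m) (l i)) n"
      by (simp add: coeff_sum)
    then show ?thesis by (simp add: interp[OF that])
  qed
  then show ?thesis by (intro exI[of _ "\<lambda>n i. coeff (l i) n"]) auto
qed

text \<open>
One half of the ball-box theorem, inside a fibre. The loops of \<open>joins_loop\<close> through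
the positions \<open>t - h i\<close> with \<open>i \<le> k\<close> move the fibre coordinate
\<open>u\<^sub>s\<close> by multiples of \<open>(h i) ^ (k - s) / fact (k - s)\<close>, and
\<open>exists_interpolation_weights\<close> combines them to any prescribed displacement. If the
displacement fits the box of size \<open>h\<close>, the required changes of
\<open>u\<^sub>k\<close> are of order \<open>h\<close>, like the lengths of the excursions in
\<open>x\<close>.
\<close>

lemma fibre_box_in_ball:
  obtains C where "C > 0"
    "\<And>t u \<delta> h. 0 < h \<Longrightarrow> (\<And>s. s > k \<Longrightarrow> u s = 0 \<and> \<delta> s = 0) \<Longrightarrow> (\<And>s. s \<le> k \<Longrightarrow> \<bar>\<delta> s\<bar> \<le> h ^ (k + 1 - s)) \<Longrightarrow>
       d_cc k (t, u) (t, \<lambda>s. u s + \<delta> s) \<le> ennreal (C * h)"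
proof -
  obtain a :: "nat \<Rightarrow> nat \<Rightarrow> real"
    where a: "\<forall>m\<le>k. \<forall>n\<le>k. (\<Sum>i\<le>k. real i ^ m * a n i) = (if m = n then 1 else 0)"
    by (rule exE[OF exists_interpolation_weights])
  define C where "C = 1 + (\<Sum>i<Suc k. 2 * real i + (\<Sum>n\<le>k. fact n * \<bar>a n i\<bar>))"
  have C: "C > 0" unfolding C_def by (intro add_pos_nonneg sum_nonneg add_nonneg_nonneg) auto
  show ?thesis
  proof (rule that[OF C])
    fix t h :: real and u \<delta> :: "nat \<Rightarrow> real"
    assume h: "0 < h" and z: "\<And>s. s > k \<Longrightarrow> u s = 0 \<and> \<delta> s = 0" and b: "\<And>s. s \<le> k \<Longrightarrow> \<bar>\<delta> s\<bar> \<le> h ^ (k + 1 - s)"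
    \<comment> \<open>The factors cancel \<open>h ^ n / fact n\<close> in the effect of a loop on the coordinate \<open>u\<^sub>s\<close> with \<open>s = k - n\<close>.\<close>
    define c where "c i = (\<Sum>n\<le>k. fact n * \<delta> (k - n) / h ^ n * a n i)" for i
    have sum: "(\<Sum>i<Suc k. c i * ((- (- (h * real i))) ^ (k - s) / fact (k - s))) = \<delta> s" if s: "s \<le> k" for s
    proof -
      define m where "m = k - s"
      have m: "m \<le> k" "k - m = s" using s by (auto simp: m_def)
      have "(\<Sum>i<Suc k. c i * ((- (- (h * real i))) ^ m / fact m))
         = (\<Sum>i\<le>k. \<Sum>n\<le>k. (fact n * \<delta> (k - n) / h ^ n * (h ^ m / fact m)) * (real i ^ m * a n i))"
        unfolding lessThan_Suc_atMost c_def sum_distrib_right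
        by (intro sum.cong refl) (simp add: power_mult_distrib)
      also have "\<dots> = (\<Sum>n\<le>k. (fact n * \<delta> (k - n) / h ^ n * (h ^ m / fact m)) * (\<Sum>i\<le>k. real i ^ m * a n i))"
        unfolding sum_distrib_left by (rule sum.swap)
      also have "\<dots> = (\<Sum>n\<le>k. if n = m then \<delta> s else 0)"
        by (rule sum.cong) (use a m h in auto)
      also have "\<dots> = \<delta> s" using m by simp
      finally show ?thesis by (simp add: m_def)
    qed
    have cb: "\<bar>c i\<bar> \<le> h * (\<Sum>n\<le>k. fact n * \<bar>a n i\<bar>)" for i
    proof -
      have "\<bar>c i\<bar> \<le> (\<Sum>n\<le>k. \<bar>fact n * \<delta> (k - n) / h ^ n * a n i\<bar>)" unfolding c_def by (rule sum_abs)
      also have "\<dots> \<le> (\<Sum>n\<le>k. h * (fact n * \<bar>a n i\<bar>))"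
      proof (rule sum_mono)
        fix n assume "n \<in> {..k}"
        then have "\<bar>\<delta> (k - n)\<bar> \<le> h * h ^ n" using b[of "k - n"] by simp
        then have "\<bar>\<delta> (k - n)\<bar> / h ^ n \<le> h" using h by (simp add: divide_simps)
        then have "\<bar>\<delta> (k - n)\<bar> / h ^ n * (fact n * \<bar>a n i\<bar>) \<le> h * (fact n * \<bar>a n i\<bar>)"
          by (rule mult_right_mono) simp
        then show "\<bar>fact n * \<delta> (k - n) / h ^ n * a n i\<bar> \<le> h * (fact n * \<bar>a n i\<bar>)"
          using h by (simp add: abs_mult mult_ac)
      qed
      finally show ?thesis by (simp add: sum_distrib_left)
    qed
    have "joins k (poly_jet k t u t) (poly_jet k t (\<lambda>s. u s + (\<Sum>i<Suc k. c i * ((- (- (h * real i))) ^ (k - s) / fact (k - s)))) t)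
       (\<Sum>i<Suc k. 2 * \<bar>- (h * real i)\<bar> + \<bar>c i\<bar>)"
      by (rule joins_loops)
    also have "poly_jet k t u t = (t, u)" using z by (auto simp: poly_jet_base fun_eq_iff)
    also have "poly_jet k t (\<lambda>s. u s + (\<Sum>i<Suc k. c i * ((- (- (h * real i))) ^ (k - s) / fact (k - s)))) t = (t, \<lambda>s. u s + \<delta> s)"
      unfolding poly_jet_base using z sum by (auto simp: fun_eq_iff)
    finally have "d_cc k (t, u) (t, \<lambda>s. u s + \<delta> s) \<le> ennreal (\<Sum>i<Suc k. 2 * \<bar>- (h * real i)\<bar> + \<bar>c i\<bar>)"
      by (rule d_cc_le_of_joins)
    also have "\<dots> \<le> ennreal (C * h)"
    proof (rule ennreal_leI)
      have "(\<Sum>i<Suc k. 2 * \<bar>- (h * real i)\<bar> + \<bar>c i\<bar>) \<le> (\<Sum>i<Suc k. h * (2 * real i + (\<Sum>n\<le>k. fact n * \<bar>a n i\<bar>)))"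
        using cb h by (intro sum_mono) (auto simp: abs_mult distrib_left)
      also have "\<dots> \<le> C * h" using h unfolding C_def sum_distrib_left[symmetric] by (simp add: algebra_simps)
      finally show "(\<Sum>i<Suc k. 2 * \<bar>- (h * real i)\<bar> + \<bar>c i\<bar>) \<le> C * h" .
    qed
    finally show "d_cc k (t, u) (t, \<lambda>s. u s + \<delta> s) \<le> ennreal (C * h)" .
  qed
qed

section \<open>Bounding Hausdorff dimension by coverings and by expanding maps\<close>

lemma hausdorff_dim_leI:
  assumes "0 \<le> \<sigma>" and "\<And>s. \<sigma> < s \<Longrightarrow> hausdorff_measure S d s E = 0"
  shows "hausdorff_dim S d E \<le> ennreal \<sigma>"
proof (rule ennreal_le_epsilon)
  fix e :: real assume "e > 0"
  then have "hausdorff_dim S d E \<le> ennreal (\<sigma> + e)"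
    unfolding hausdorff_dim_def using assms by (intro INF_lower) auto
  then show "hausdorff_dim S d E \<le> ennreal \<sigma> + ennreal e" using assms(1) \<open>e > 0\<close> by (simp add: ennreal_plus)
qed

lemma hausdorff_dim_le_of_covers:
  fixes U :: "nat \<Rightarrow> nat \<Rightarrow> 'a set" and N :: "nat \<Rightarrow> nat" and K M \<sigma> :: real
  assumes \<sigma>: "\<sigma> > 0" and K: "K > 0"
    and cov: "\<And>n. E \<subseteq> (\<Union>i<N n. U n i)" and N: "\<And>n. real (N n) \<le> M * 2 ^ n"
    and US: "\<And>n i. U n i \<subseteq> S" and diam: "\<And>n i. set_diam d (U n i) \<le> ennreal (K * (2 powr (- 1 / \<sigma>)) ^ n)"
  shows "hausdorff_dim S d E \<le> ennreal \<sigma>"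
proof (rule hausdorff_dim_leI)
  fix s :: real assume s: "\<sigma> < s"
  define \<rho> where "\<rho> = (2::real) powr (- 1 / \<sigma>)"
  have \<rho>: "0 < \<rho>" "\<rho> < 1" using \<sigma> by (simp_all add: \<rho>_def powr_less_one divide_neg_pos)
  \<comment> \<open>At stage \<open>n\<close> there are of order \<open>2 ^ n\<close> sets with \<open>s\<close>-th power of the diameter of order \<open>\<rho> powr (s * n)\<close>, and \<open>q < 1\<close> because \<open>2 * \<rho> powr \<sigma> = 1\<close>.\<close>
  define q where "q = 2 * \<rho> powr s"
  have "\<rho> powr s = 2 powr (- (s / \<sigma>))" by (simp add: \<rho>_def powr_powr)
  also have "\<dots> < 2 powr (- 1)" using s \<sigma> by (intro powr_less_mono) (auto simp: divide_simps)
  finally have q: "0 < q" "q < 1" using \<rho> by (simp_all add: q_def powr_minus)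
  have M: "0 \<le> M" using N[of 0] by (simp add: order_trans[OF of_nat_0_le_iff])
  have content: "hausdorff_content S d s \<delta> E \<le> ennreal (M * K powr s * q ^ n)"
    if "K * \<rho> ^ n \<le> \<delta>" for \<delta> n
  proof -
    define V where "V i = (if i < N n then U n i else {})" for i
    have dV: "set_diam d (V i) \<le> ennreal (K * \<rho> ^ n)" for i
      using diam[of n i] by (simp add: V_def \<rho>_def set_diam_def)
    have pr: "(K * \<rho> ^ n) powr s = K powr s * (\<rho> powr s) ^ n"
      using K \<rho> by (simp add: powr_mult powr_realpow[symmetric] powr_powr mult.commute)
    have "hausdorff_content S d s \<delta> E \<le> (\<Sum>i. ennreal (enn2real (set_diam d (V i)) powr s))"
      unfolding hausdorff_content_def
    proof (rule INF_lower, safe)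
      show "x \<in> S" if "x \<in> V i" for i x using US that by (auto simp: V_def split: if_splits)
      show "set_diam d (V i) \<le> ennreal \<delta>" for i
        using order_trans[OF dV ennreal_leI[OF that]] .
      show "x \<in> (\<Union>i. V i)" if xE: "x \<in> E" for x
      proof -
        obtain i where "i < N n" "x \<in> U n i" using subsetD[OF cov[of n] xE] by auto
        then have "x \<in> V i" by (simp add: V_def)
        then show ?thesis by blast
      qed
    qed
    also have "\<dots> = (\<Sum>i<N n. ennreal (enn2real (set_diam d (V i)) powr s))"
      by (rule suminf_finite) (auto simp: V_def set_diam_def bot_ennreal)
    also have "\<dots> \<le> (\<Sum>i<N n. ennreal ((K * \<rho> ^ n) powr s))"
    proof (intro sum_mono ennreal_leI powr_mono2)
      show "enn2real (set_diam d (V i)) \<le> K * \<rho> ^ n" for i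
        using enn2real_mono[OF dV[of i]] K \<rho> by simp
    qed (use s \<sigma> in auto)
    also have "\<dots> = ennreal (real (N n) * (K * \<rho> ^ n) powr s)"
      by (simp add: ennreal_mult' ennreal_of_nat_eq_real_of_nat)
    also have "\<dots> \<le> ennreal (M * 2 ^ n * (K powr s * (\<rho> powr s) ^ n))"
      unfolding pr by (intro ennreal_leI mult_right_mono N) auto
    also have "M * 2 ^ n * (K powr s * (\<rho> powr s) ^ n) = M * K powr s * q ^ n"
      by (simp add: q_def power_mult_distrib)
    finally show ?thesis .
  qed
  have "hausdorff_content S d s \<delta> E \<le> 0" if "\<delta> > 0" for \<delta>
  proof (rule tendsto_lowerbound)
    have "(\<lambda>n. M * K powr s * q ^ n) \<longlonglongrightarrow> M * K powr s * 0"
      using q by (intro tendsto_intros LIMSEQ_power_zero) auto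
    then show "(\<lambda>n. ennreal (M * K powr s * q ^ n)) \<longlonglongrightarrow> 0"
      using tendsto_ennrealI by fastforce
    have "(\<lambda>n. K * \<rho> ^ n) \<longlonglongrightarrow> K * 0"
      using \<rho> by (intro tendsto_intros LIMSEQ_power_zero) auto
    then have "\<forall>\<^sub>F n in sequentially. K * \<rho> ^ n < \<delta>"
      using that by (simp add: order_tendstoD(2))
    then show "\<forall>\<^sub>F n in sequentially. hausdorff_content S d s \<delta> E \<le> ennreal (M * K powr s * q ^ n)"
      by (rule eventually_mono) (rule content, simp)
  qed simp
  then have "hausdorff_measure S d s E \<le> 0"
    unfolding hausdorff_measure_def by (intro SUP_least) auto
  then show "hausdorff_measure S d s E = 0" by simp
qed (use \<sigma> in simp)

text \<open>
A mass distribution principle without a measure on \<open>E\<close>: the preimages under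
\<open>g\<close> of a covering of \<open>E\<close> cover the unit interval, and a set of diameter
\<open>\<delta>\<close> has a preimage of length of order at most \<open>\<delta> powr
\<sigma>\<close>. So for \<open>s \<le> \<sigma>\<close> the \<open>s\<close>-dimensional sums of
coverings by sets of diameter at most \<open>1\<close> are bounded below.
\<close>

lemma le_hausdorff_dim_of_expanding_map:
  fixes g :: "real \<Rightarrow> 'a" and \<sigma> \<kappa> :: real
  assumes \<sigma>: "\<sigma> > 0" and \<kappa>: "\<kappa> > 0"
    and g: "\<And>y. y \<in> {0..<1} \<Longrightarrow> g y \<in> E"
    and exp: "\<And>y y'. y \<in> {0..<1} \<Longrightarrow> y' \<in> {0..<1} \<Longrightarrow> ennreal (\<kappa> * \<bar>y - y'\<bar> powr (1 / \<sigma>)) \<le> d (g y) (g y')"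
  shows "ennreal \<sigma> \<le> hausdorff_dim S d E"
  unfolding hausdorff_dim_def
proof (rule INF_greatest, rule ccontr)
  fix s assume "s \<in> {s. 0 < s \<and> hausdorff_measure S d s E = 0}" and "\<not> ennreal \<sigma> \<le> ennreal s"
  then have s: "0 < s" "s < \<sigma>" and H: "hausdorff_measure S d s E = 0"
    using \<sigma> by (auto simp: ennreal_le_iff not_le intro: ccontr)
  define c where "c = 2 * \<kappa> powr (- \<sigma>)"
  have c: "c > 0" using \<kappa> by (simp add: c_def)
  have "ennreal (1 / c) \<le> hausdorff_content S d s 1 E"
    unfolding hausdorff_content_def
  proof (rule INF_greatest, clarify)
    fix U :: "nat \<Rightarrow> 'a set"
    assume U: "\<forall>i. U i \<subseteq> S \<and> set_diam d (U i) \<le> ennreal 1" and cov: "E \<subseteq> (\<Union>i. U i)"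
    define \<delta> where "\<delta> i = enn2real (set_diam d (U i))" for i
    have \<delta>: "0 \<le> \<delta> i" "\<delta> i \<le> 1" "set_diam d (U i) = ennreal (\<delta> i)" for i
    proof -
      have "set_diam d (U i) \<le> ennreal 1" using U by blast
      then have "set_diam d (U i) < \<infinity>" by (simp add: le_less_trans)
      then show "set_diam d (U i) = ennreal (\<delta> i)" by (simp add: \<delta>_def)
      show "\<delta> i \<le> 1" using enn2real_mono[OF \<open>set_diam d (U i) \<le> ennreal 1\<close>] by (simp add: \<delta>_def)
    qed (simp add: \<delta>_def)
    define V where "V i = {y \<in> {0..<1}. g y \<in> U i}" for i
    have close: "\<bar>y - y'\<bar> \<le> \<kappa> powr (- \<sigma>) * \<delta> i powr s" if "y \<in> V i" "y' \<in> V i" for i y y'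
    proof -
      have "ennreal (\<kappa> * \<bar>y - y'\<bar> powr (1 / \<sigma>)) \<le> d (g y) (g y')"
        using that by (intro exp) (auto simp: V_def)
      also have "\<dots> \<le> set_diam d (U i)"
        using that unfolding set_diam_def V_def by (intro SUP_upper2[of "g y"] SUP_upper2[of "g y'"]) auto
      finally have "\<kappa> * \<bar>y - y'\<bar> powr (1 / \<sigma>) \<le> \<delta> i"
        using \<delta> by (simp add: ennreal_le_iff)
      then have "\<bar>y - y'\<bar> powr (1 / \<sigma>) \<le> \<delta> i / \<kappa>" using \<kappa> by (simp add: field_simps)
      then have "(\<bar>y - y'\<bar> powr (1 / \<sigma>)) powr \<sigma> \<le> (\<delta> i / \<kappa>) powr \<sigma>"
        using \<sigma> by (intro powr_mono2) auto
      then have "\<bar>y - y'\<bar> \<le> (\<delta> i / \<kappa>) powr \<sigma>" using \<sigma> by (simp add: powr_powr)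
      also have "\<dots> = \<kappa> powr (- \<sigma>) * \<delta> i powr \<sigma>"
        using \<kappa> \<delta>(1)[of i] by (simp add: powr_divide powr_minus divide_simps)
      also have "\<dots> \<le> \<kappa> powr (- \<sigma>) * \<delta> i powr s"
      proof (intro mult_left_mono)
        show "\<delta> i powr \<sigma> \<le> \<delta> i powr s"
          using s \<delta>(1,2)[of i] by (intro powr_mono') auto
      qed simp
      finally show ?thesis .
    qed
    have "\<exists>I. V i \<subseteq> I \<and> I \<in> sets lborel \<and> emeasure lborel I \<le> ennreal (c * \<delta> i powr s)" for i
    proof (cases "V i = {}")
      case True then show ?thesis by (intro exI[of _ "{}"]) simp
    next
      case False
      then obtain y where y: "y \<in> V i" by blast
      define l where "l = \<kappa> powr (- \<sigma>) * \<delta> i powr s"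
      have l: "0 \<le> l" by (simp add: l_def)
      have "V i \<subseteq> {y - l..y + l}"
      proof
        fix y' assume "y' \<in> V i"
        then show "y' \<in> {y - l..y + l}" using close[OF _ y, of y'] unfolding l_def[symmetric] by (auto simp: abs_le_iff)
      qed
      moreover have "emeasure lborel {y - l..y + l} = ennreal (c * \<delta> i powr s)"
        using l by (simp add: c_def l_def)
      ultimately show ?thesis by (intro exI[of _ "{y - l..y + l}"]) simp
    qed
    then obtain I where I: "\<And>i. V i \<subseteq> I i" "\<And>i. I i \<in> sets lborel" "\<And>i. emeasure lborel (I i) \<le> ennreal (c * \<delta> i powr s)"
      by metis
    have "{0..<1} \<subseteq> (\<Union>i. I i)"
    proof
      fix y :: real assume y: "y \<in> {0..<1}"
      then obtain i where "g y \<in> U i" using g cov by blast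
      then have "y \<in> V i" using y by (simp add: V_def)
      then show "y \<in> (\<Union>i. I i)" using I(1) by blast
    qed
    then have "emeasure lborel {0..<1::real} \<le> emeasure lborel (\<Union>i. I i)"
      by (rule emeasure_mono) (use I(2) in auto)
    then have "1 \<le> emeasure lborel (\<Union>i. I i)" by simp
    also have "\<dots> \<le> (\<Sum>i. emeasure lborel (I i))"
      by (rule emeasure_subadditive_countably) (use I(2) in auto)
    also have "\<dots> \<le> (\<Sum>i. ennreal c * ennreal (\<delta> i powr s))"
      using I(3) c by (intro suminf_le) (auto simp flip: ennreal_mult)
    also have "\<dots> = ennreal c * (\<Sum>i. ennreal (\<delta> i powr s))" by simp
    finally have "ennreal (1 / c) * 1 \<le> ennreal (1 / c) * (ennreal c * (\<Sum>i. ennreal (\<delta> i powr s)))"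
      by (rule mult_left_mono) simp
    also have "\<dots> = (\<Sum>i. ennreal (\<delta> i powr s))"
      using c by (simp flip: mult.assoc ennreal_mult)
    finally show "ennreal (1 / c) \<le> (\<Sum>i. ennreal (enn2real (set_diam d (U i)) powr s))"
      by (simp add: \<delta>_def)
  qed
  also have "\<dots> \<le> hausdorff_measure S d s E"
    unfolding hausdorff_measure_def by (rule SUP_upper) simp
  finally show False using c H by simp
qed

lemma hausdorff_dim_empty: "hausdorff_dim S d {} = 0"
proof -
  have "hausdorff_dim S d {} \<le> ennreal 0"
  proof (rule hausdorff_dim_leI)
    fix s :: real
    have "hausdorff_content S d s \<delta> {} \<le> (\<Sum>i::nat. ennreal (enn2real (set_diam d {}) powr s))" for \<delta>
      unfolding hausdorff_content_def by (rule INF_lower2[of "\<lambda>_. {}"]) (auto simp: set_diam_def)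
    moreover have "set_diam d {} = 0" by (simp add: set_diam_def bot_ennreal)
    ultimately have "hausdorff_measure S d s {} \<le> 0"
      unfolding hausdorff_measure_def by (intro SUP_least) auto
    then show "hausdorff_measure S d s {} = 0" by simp
  qed simp
  then show ?thesis by simp
qed

section \<open>Cantor sets of prescribed dimension\<close>

fun cantor_level :: "real \<Rightarrow> nat \<Rightarrow> real set" where
  "cantor_level r 0 = {0..1}"
| "cantor_level r (Suc n) = (\<lambda>x. r * x) ` cantor_level r n \<union> (\<lambda>x. 1 - r + r * x) ` cantor_level r n"

definition cantor_set :: "real \<Rightarrow> real set" where
  "cantor_set r = (\<Inter>n. cantor_level r n)"

lemma compact_cantor_level: "compact (cantor_level r n)"
proof (induction n)
  case (Suc n)
  show ?case unfolding cantor_level.simps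
    by (intro compact_Un compact_continuous_image Suc.IH continuous_intros)
qed simp

lemma compact_cantor_set: "compact (cantor_set r)"
  unfolding cantor_set_def
proof (rule compact_Inter[of "range (cantor_level r)", simplified])
qed (auto simp: compact_cantor_level)

lemma cantor_set_subset: "cantor_set r \<subseteq> {0..1}"
  unfolding cantor_set_def using cantor_level.simps(1)[of r] by blast

lemma cantor_level_cover:
  assumes "0 \<le> r"
  shows "\<exists>l :: nat \<Rightarrow> real. cantor_level r n \<subseteq> (\<Union>i<2 ^ n. {l i..l i + r ^ n})"
proof (induction n)
  case 0
  show ?case by (intro exI[of _ "\<lambda>_. 0"]) (auto simp: lessThan_empty_iff bot_nat_def)
next
  case (Suc n)
  then obtain l :: "nat \<Rightarrow> real" where l: "cantor_level r n \<subseteq> (\<Union>i<2 ^ n. {l i..l i + r ^ n})" by blast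
  define l' where "l' i = (if i < 2 ^ n then r * l i else 1 - r + r * l (i - 2 ^ n))" for i
  have "\<exists>i<2 ^ Suc n. x \<in> {l' i..l' i + r ^ Suc n}" if xL: "x \<in> cantor_level r (Suc n)" for x
  proof -
    obtain z where z: "z \<in> cantor_level r n" "x = r * z \<or> x = 1 - r + r * z"
      using xL by auto
    obtain i where i: "i < 2 ^ n" "l i \<le> z" "z \<le> l i + r ^ n" using l z by force
    have b: "r * l i \<le> r * z" "r * z \<le> r * l i + r ^ Suc n"
      using mult_left_mono[OF i(2) assms] mult_left_mono[OF i(3) assms] by (simp_all add: algebra_simps)
    from z(2) show ?thesis
    proof
      assume "x = r * z"
      then show ?thesis using i b by (intro exI[of _ i]) (auto simp: l'_def)
    next
      assume "x = 1 - r + r * z"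
      then show ?thesis using i b by (intro exI[of _ "i + 2 ^ n"]) (auto simp: l'_def)
    qed
  qed
  then have "cantor_level r (Suc n) \<subseteq> (\<Union>i<2 ^ Suc n. {l' i..l' i + r ^ Suc n})" by blast
  then show ?case by (rule exI[of _ l'])
qed

text \<open>
The functional equations say that \<open>g\<close> maps the two halves of the unit interval to the
two pieces of the Cantor set. Points of different halves are separated by the gap \<open>1 - 2 *
r\<close>. Doubling the distance of two points of the same half scales the distance of their
values by \<open>1 / r\<close>, which gives the induction on \<open>n\<close>.
\<close>

lemma cantor_parametrization_expanding:
  fixes g :: "real \<Rightarrow> real"
  assumes r: "0 \<le> r" "r \<le> 1 / 2"
    and low: "\<And>y. y \<in> {0..<1/2} \<Longrightarrow> g y = r * g (2 * y)"
    and high: "\<And>y. y \<in> {1/2..<1} \<Longrightarrow> g y = 1 - r + r * g (2 * y - 1)"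
    and rng: "\<And>y. y \<in> {0..<1} \<Longrightarrow> g y \<in> {0..1}"
  shows "y \<in> {0..<1} \<Longrightarrow> y' \<in> {0..<1} \<Longrightarrow> y + 1 / 2 ^ n \<le> y' \<Longrightarrow> (1 - 2 * r) * r ^ n \<le> g y' - g y"
proof (induction n arbitrary: y y')
  case 0
  then show ?case by simp
next
  case (Suc n)
  have step: "r * ((1 - 2 * r) * r ^ n) \<le> r * (g v - g u)"
    if "u \<in> {0..<1}" "v \<in> {0..<1}" "u + 1 / 2 ^ n \<le> v" for u v
    by (intro mult_left_mono Suc.IH that r)
  have lt: "y < y'" using Suc.prems(3) by (smt (verit) zero_less_divide_1_iff zero_less_power)
  have gap: "2 * y + 1 / 2 ^ n \<le> 2 * y'" using Suc.prems(3) by (simp add: field_simps)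
  consider "y' < 1/2" | "1/2 \<le> y" | "y < 1/2" "1/2 \<le> y'" by linarith
  then show ?case
  proof cases
    case 1
    then show ?thesis using step[of "2 * y" "2 * y'"] gap Suc.prems lt low[of y] low[of y']
      by (simp add: algebra_simps)
  next
    case 2
    then show ?thesis using step[of "2 * y - 1" "2 * y' - 1"] gap Suc.prems lt high[of y] high[of y']
      by (simp add: algebra_simps)
  next
    case 3
    have "g (2 * y) \<le> 1" "0 \<le> g (2 * y' - 1)"
      using rng[of "2 * y"] rng[of "2 * y' - 1"] 3 Suc.prems by auto
    then have "r * g (2 * y) \<le> r * 1" "0 \<le> r * g (2 * y' - 1)"
      using r by (intro mult_left_mono mult_nonneg_nonneg; simp)+
    moreover have "g y = r * g (2 * y)" "g y' = 1 - r + r * g (2 * y' - 1)"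
      using low[of y] high[of y'] 3 Suc.prems by auto
    moreover have "(1 - 2 * r) * r ^ Suc n \<le> (1 - 2 * r) * 1"
      using r by (intro mult_left_mono power_le_one) auto
    ultimately show ?thesis unfolding mult_1_right by linarith
  qed
qed

lemma cantor_parametrization_mem:
  fixes g :: "real \<Rightarrow> real"
  assumes low: "\<And>y. y \<in> {0..<1/2} \<Longrightarrow> g y = r * g (2 * y)"
    and high: "\<And>y. y \<in> {1/2..<1} \<Longrightarrow> g y = 1 - r + r * g (2 * y - 1)"
    and rng: "\<And>y. y \<in> {0..<1} \<Longrightarrow> g y \<in> {0..1}"
    and y: "y \<in> {0..<1}"
  shows "g y \<in> cantor_set r"
proof -
  have "g y \<in> cantor_level r n" if "y \<in> {0..<1}" for n y
    using that
  proof (induction n arbitrary: y)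
    case 0 then show ?case using rng by simp
  next
    case (Suc n)
    show ?case
    proof (cases "y < 1/2")
      case True
      then have "g (2 * y) \<in> cantor_level r n" using Suc.prems by (intro Suc.IH) auto
      moreover have "g y = r * g (2 * y)" using True Suc.prems by (intro low) auto
      ultimately show ?thesis by auto
    next
      case False
      then have "g (2 * y - 1) \<in> cantor_level r n" using Suc.prems by (intro Suc.IH) auto
      moreover have "g y = 1 - r + r * g (2 * y - 1)" using False Suc.prems by (intro high) auto
      ultimately show ?thesis by auto
    qed
  qed
  then show ?thesis using y by (auto simp: cantor_set_def)
qed

text \<open>
The \<open>n\<close>-th digit after the binary point, counted from \<open>0\<close>.
\<close>

definition binary_digit :: "nat \<Rightarrow> real \<Rightarrow> real" where
  "binary_digit n y = (if frac (2 ^ n * y) < 1 / 2 then 0 else 1)"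

definition cantor_param :: "real \<Rightarrow> real \<Rightarrow> real" where
  "cantor_param r y = (\<Sum>n. (1 - r) * r ^ n * binary_digit n y)"

lemma cantor_param_summable:
  assumes "0 \<le> r" "r < 1"
  shows "summable (\<lambda>n. (1 - r) * r ^ n * binary_digit n y)"
proof (rule summable_comparison_test')
  show "summable (\<lambda>n. (1 - r) * r ^ n)" using assms by (intro summable_mult summable_geometric) simp
qed (use assms in \<open>simp add: binary_digit_def\<close>)

lemma cantor_param_range:
  assumes "0 \<le> r" "r < 1" shows "cantor_param r y \<in> {0..1}"
proof -
  have s: "(\<lambda>n. (1 - r) * r ^ n) sums ((1 - r) * (1 / (1 - r)))"
    using assms by (intro sums_mult geometric_sums) simp
  have "cantor_param r y \<le> (\<Sum>n. (1 - r) * r ^ n)"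
    unfolding cantor_param_def using assms s
    by (intro suminf_le cantor_param_summable) (auto simp: binary_digit_def sums_iff)
  also have "\<dots> = 1" using s assms by (simp add: sums_iff)
  finally have "cantor_param r y \<le> 1" .
  moreover have "0 \<le> cantor_param r y"
    unfolding cantor_param_def by (intro suminf_nonneg cantor_param_summable assms) (use assms in \<open>auto simp: binary_digit_def\<close>)
  ultimately show ?thesis by simp
qed

lemma cantor_param_step:
  assumes "0 \<le> r" "r < 1"
  shows "cantor_param r y = (1 - r) * binary_digit 0 y + r * cantor_param r (2 * y)"
proof -
  have d: "binary_digit (Suc n) y = binary_digit n (2 * y)" for n
    by (simp add: binary_digit_def mult.assoc mult.left_commute)
  have "cantor_param r y = (\<Sum>n. (1 - r) * r ^ Suc n * binary_digit (Suc n) y) + (1 - r) * r ^ 0 * binary_digit 0 y"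
    unfolding cantor_param_def by (subst suminf_split_head[OF cantor_param_summable[OF assms]]) simp
  also have "(\<lambda>n. (1 - r) * r ^ Suc n * binary_digit (Suc n) y) = (\<lambda>n. r * ((1 - r) * r ^ n * binary_digit n (2 * y)))"
    by (simp add: d fun_eq_iff)
  also have "(\<Sum>n. r * ((1 - r) * r ^ n * binary_digit n (2 * y))) = r * cantor_param r (2 * y)"
    unfolding cantor_param_def by (rule suminf_mult[OF cantor_param_summable[OF assms]])
  finally show ?thesis by simp
qed

text \<open>
Periodicity turns the value at \<open>2 * y\<close> produced by \<open>cantor_param_step\<close>
into the value at \<open>2 * y - 1\<close> when \<open>y \<ge> 1 / 2\<close>.
\<close>

lemma cantor_param_periodic: "cantor_param r (y - 1) = cantor_param r y"
proof -
  have "binary_digit n (y - 1) = binary_digit n y" for n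
  proof -
    have "2 ^ n * (y - 1) = 2 ^ n * y - of_int (2 ^ n)" by (simp add: algebra_simps)
    then have "frac (2 ^ n * (y - 1)) = frac (2 ^ n * y)" by (simp add: frac_def del: of_int_power)
    then show ?thesis by (simp add: binary_digit_def)
  qed
  then show ?thesis by (simp add: cantor_param_def)
qed

text \<open>
The inverse of \<open>g\<close> is a version of the Cantor function, which is Hoelder of exponent
\<open>\<mu>\<close>. For \<open>\<mu> = 1\<close> the gap \<open>1 - 2 * r\<close> vanishes, but
then the Cantor set is the unit interval and the identity serves as \<open>g\<close>.
\<close>

lemma exists_cantor_parametrization:
  fixes \<mu> :: real
  assumes \<mu>: "0 < \<mu>" "\<mu> \<le> 1"
  defines "r \<equiv> 2 powr (- 1 / \<mu>)"
  obtains g \<kappa> where "\<kappa> > 0" "\<And>y. y \<in> {0..<1} \<Longrightarrow> g y \<in> cantor_set r"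
    "\<And>y y'. y \<in> {0..<1} \<Longrightarrow> y' \<in> {0..<1} \<Longrightarrow> \<kappa> * \<bar>y - y'\<bar> powr (1 / \<mu>) \<le> \<bar>g y - g y'\<bar>"
proof (cases "\<mu> = 1")
  case True
  have r: "r = 1 / 2" using True by (simp add: r_def powr_minus)
  show ?thesis
  proof (rule that[of 1 "\<lambda>y. y"])
    show "y \<in> cantor_set r" if "y \<in> {0..<1}" for y
      by (rule cantor_parametrization_mem[of "\<lambda>y. y"]) (use that in \<open>auto simp: r field_simps\<close>)
  qed (use True in auto)
next
  case False
  then have \<mu>1: "\<mu> < 1" using \<mu> by simp
  have "r < 2 powr (- 1)" unfolding r_def using \<mu> \<mu>1 by (intro powr_less_mono) (auto simp: divide_simps)
  then have r: "0 < r" "r < 1 / 2" by (auto simp: r_def powr_minus)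
  define g where "g = cantor_param r"
  have rng: "g y \<in> {0..1}" for y unfolding g_def by (rule cantor_param_range) (use r in auto)
  have low: "g y = r * g (2 * y)" if "y \<in> {0..<1/2}" for y
    using cantor_param_step[of r y] r that by (simp add: g_def binary_digit_def frac_eq[THEN iffD2])
  have high: "g y = 1 - r + r * g (2 * y - 1)" if "y \<in> {1/2..<1}" for y
    using cantor_param_step[of r y] r that by (simp add: g_def binary_digit_def frac_eq[THEN iffD2] cantor_param_periodic)
  define \<kappa> where "\<kappa> = (1 - 2 * r) * (1/2) powr (1 / \<mu>)"
  have \<kappa>: "\<kappa> > 0" using r by (simp add: \<kappa>_def)
  have main: "\<kappa> * (y' - y) powr (1 / \<mu>) \<le> g y' - g y" if y: "y \<in> {0..<1}" "y' \<in> {0..<1}" and lt: "y < y'" for y y'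
  proof -
    have ex: "\<exists>n. (1/2::real) ^ n \<le> y' - y"
      using real_arch_pow_inv[of "y' - y" "1/2"] lt by (auto intro: less_imp_le)
    \<comment> \<open>The scale of \<open>y' - y\<close>: minimality gives \<open>y' - y < 2 * (1/2) ^ n\<close>.\<close>
    define n where "n = (LEAST n. (1/2::real) ^ n \<le> y' - y)"
    have n: "(1/2) ^ n \<le> y' - y" unfolding n_def by (rule LeastI_ex[OF ex])
    have "n \<noteq> 0" using n y by (intro notI) simp
    then obtain m where m: "n = Suc m" by (cases n) auto
    then have "\<not> (1/2) ^ m \<le> y' - y" unfolding n_def by (metis lessI not_less_Least)
    then have b: "(y' - y) / 2 \<le> (1/2) ^ n" by (simp add: m)
    have "\<kappa> * (y' - y) powr (1 / \<mu>) = (1 - 2 * r) * ((y' - y) / 2) powr (1 / \<mu>)"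
      using lt by (simp add: \<kappa>_def powr_mult[symmetric])
    also have "\<dots> \<le> (1 - 2 * r) * ((1/2) ^ n) powr (1 / \<mu>)"
      using r lt b \<mu> by (intro mult_left_mono powr_mono2) auto
    also have "((1/2::real) ^ n) powr (1 / \<mu>) = r ^ n"
    proof -
      have "((1/2::real) ^ n) powr (1 / \<mu>) = ((1/2) powr (1 / \<mu>)) ^ n"
        by (simp add: powr_realpow[symmetric] powr_powr mult.commute)
      also have "(1/2::real) powr (1 / \<mu>) = r" by (simp add: r_def powr_divide powr_minus divide_simps)
      finally show ?thesis .
    qed
    also have "(1 - 2 * r) * r ^ n \<le> g y' - g y"
      by (rule cantor_parametrization_expanding[of r g])
        (use r low high rng y n in \<open>auto simp: power_divide\<close>)
    finally show ?thesis .
  qed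
  show ?thesis
  proof (rule that[OF \<kappa>])
    show "g y \<in> cantor_set r" if "y \<in> {0..<1}" for y
      by (rule cantor_parametrization_mem[OF low high rng that])
    show "\<kappa> * \<bar>y - y'\<bar> powr (1 / \<mu>) \<le> \<bar>g y - g y'\<bar>" if "y \<in> {0..<1}" "y' \<in> {0..<1}" for y y'
    proof (cases y y' rule: linorder_cases)
      case less
      then show ?thesis using main[OF that less] by (simp add: abs_minus_commute)
    next
      case greater
      then show ?thesis using main[OF that(2,1) greater] by (simp add: abs_minus_commute)
    qed simp
  qed
qed

definition two_cantor_sets :: "real \<Rightarrow> real set" where
  "two_cantor_sets r = cantor_set r \<union> (\<lambda>x. x + 3) ` cantor_set r"

lemma compact_two_cantor_sets: "compact (two_cantor_sets r)"
  unfolding two_cantor_sets_def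
  by (intro compact_Un compact_continuous_image continuous_intros compact_cantor_set)

text \<open>
A Hoelder map of exponent \<open>\<theta>\<close> multiplies dimensions by at most \<open>1 /
\<theta>\<close>. The Hoelder bound is only demanded at distance at most \<open>1\<close>: the
\<open>2 * 2 ^ n\<close> intervals of length \<open>r ^ n\<close> that cover the set are at most
that long.
\<close>

lemma hausdorff_dim_hoelder_image_le:
  fixes F :: "real \<Rightarrow> 'a" and \<mu> \<theta> K :: real
  assumes \<mu>: "0 < \<mu>" and \<theta>: "0 < \<theta>" and K: "0 < K" and FS: "\<And>x. F x \<in> S"
    and hoelder: "\<And>x x'. x \<in> {0..4} \<Longrightarrow> x' \<in> {0..4} \<Longrightarrow> \<bar>x - x'\<bar> \<le> 1 \<Longrightarrow>
      d (F x) (F x') \<le> ennreal (K * \<bar>x - x'\<bar> powr \<theta>)"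
  shows "hausdorff_dim S d (F ` two_cantor_sets (2 powr (- 1 / \<mu>))) \<le> ennreal (\<mu> / \<theta>)"
proof -
  define r where "r = (2::real) powr (- 1 / \<mu>)"
  have "r \<le> 2 powr 0" unfolding r_def using \<mu> by (intro powr_mono) auto
  then have r: "0 < r" "r \<le> 1" by (simp_all add: r_def)
  obtain l :: "nat \<Rightarrow> nat \<Rightarrow> real" where l: "\<And>n. cantor_level r n \<subseteq> (\<Union>i<2 ^ n. {l n i..l n i + r ^ n})"
    using cantor_level_cover[of r] r by (metis less_imp_le)
  define I where "I n j = {l n (j mod 2 ^ n)..l n (j mod 2 ^ n) + r ^ n} \<inter> {0..1}" for n j
  define a :: "nat \<Rightarrow> nat \<Rightarrow> real" where "a n j = (if j < 2 ^ n then 0 else 3)" for n j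
  define U where "U n j = (\<lambda>x. F (x + a n j)) ` I n j" for n j
  have rn: "r ^ n \<le> 1" for n using r by (simp add: power_le_one)
  show ?thesis
    unfolding r_def[symmetric]
  proof (rule hausdorff_dim_le_of_covers[where U = U and N = "\<lambda>n. 2 * 2 ^ n" and M = 2 and K = K])
    show "0 < \<mu> / \<theta>" using \<mu> \<theta> by simp
    show "U n j \<subseteq> S" for n j using FS by (auto simp: U_def)
    show "F ` two_cantor_sets r \<subseteq> (\<Union>j<2 * 2 ^ n. U n j)" for n
    proof
      fix p assume "p \<in> F ` two_cantor_sets r"
      then obtain x where x: "x \<in> cantor_set r" "p = F x \<or> p = F (x + 3)" by (auto simp: two_cantor_sets_def)
      have "x \<in> cantor_level r n" using x(1) by (simp add: cantor_set_def)
      have "x \<in> {0..1}" using subsetD[OF cantor_set_subset x(1)] .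
      obtain i where i: "i < 2 ^ n" "x \<in> {l n i..l n i + r ^ n}"
        using l[of n] \<open>x \<in> cantor_level r n\<close> by blast
      have "p \<in> U n i \<or> p \<in> U n (i + 2 ^ n)"
        using x(2)
      proof
        assume "p = F x"
        then have "p \<in> U n i" using i \<open>x \<in> {0..1}\<close> unfolding U_def by (intro image_eqI[of _ _ x]) (auto simp: I_def a_def)
        then show ?thesis ..
      next
        assume "p = F (x + 3)"
        then have "p \<in> U n (i + 2 ^ n)" using i \<open>x \<in> {0..1}\<close> unfolding U_def
          by (intro image_eqI[of _ _ x]) (auto simp: I_def a_def)
        then show ?thesis ..
      qed
      moreover have "i < 2 * 2 ^ n" "i + 2 ^ n < 2 * 2 ^ n" using i by auto
      ultimately show "p \<in> (\<Union>j<2 * 2 ^ n. U n j)" by blast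
    qed
    show "set_diam d (U n j) \<le> ennreal (K * (2 powr (- 1 / (\<mu> / \<theta>))) ^ n)" for n j
    proof -
      have "(2 powr (- 1 / (\<mu> / \<theta>))) ^ n = (r ^ n) powr \<theta>"
      proof -
        have "(2 powr (- 1 / (\<mu> / \<theta>))) ^ n = (r powr \<theta>) ^ n" by (simp add: r_def powr_powr)
        also have "\<dots> = (r ^ n) powr \<theta>"
          using r by (simp add: powr_realpow[symmetric] powr_powr mult.commute)
        finally show ?thesis .
      qed
      moreover have "d p q \<le> ennreal (K * (r ^ n) powr \<theta>)" if pq: "p \<in> U n j" "q \<in> U n j" for p q
      proof -
        obtain x where x: "x \<in> I n j" "p = F (x + a n j)" using pq(1) by (auto simp: U_def)
        obtain y where y: "y \<in> I n j" "q = F (y + a n j)" using pq(2) by (auto simp: U_def)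
        have xy: "\<bar>x - y\<bar> \<le> r ^ n" using x y by (auto simp: I_def abs_le_iff)
        have m: "x + a n j \<in> {0..4}" "y + a n j \<in> {0..4}" using x y by (auto simp: I_def a_def)
        have "d p q \<le> ennreal (K * \<bar>x - y\<bar> powr \<theta>)"
          using hoelder[OF m] xy rn[of n] x y by simp
        also have "\<dots> \<le> ennreal (K * (r ^ n) powr \<theta>)"
          using xy K \<theta> by (intro ennreal_leI mult_left_mono powr_mono2) auto
        finally show ?thesis .
      qed
      ultimately show ?thesis unfolding set_diam_def by (auto intro!: SUP_least)
    qed
  qed (use K in auto)
qed

text \<open>
Expansion is only demanded on one of the two unit intervals, chosen by \<open>a\<close>, because
one copy of the Cantor set already has the full dimension.
\<close>

lemma hausdorff_dim_expanding_image_ge: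
  fixes F :: "real \<Rightarrow> 'a" and \<mu> \<theta> c a :: real
  assumes \<mu>: "0 < \<mu>" "\<mu> \<le> 1" and \<theta>: "0 < \<theta>" and c: "0 < c"
    and expand: "\<And>x x'. x \<in> {0..1} \<Longrightarrow> x' \<in> {0..1} \<Longrightarrow> ennreal (c * \<bar>x - x'\<bar> powr \<theta>) \<le> d (F (x + a)) (F (x' + a))"
    and a: "a = 0 \<or> a = 3"
  shows "ennreal (\<mu> / \<theta>) \<le> hausdorff_dim S d (F ` two_cantor_sets (2 powr (- 1 / \<mu>)))"
proof -
  define r where "r = (2::real) powr (- 1 / \<mu>)"
  obtain g \<kappa> where \<kappa>: "\<kappa> > 0" and gC: "\<And>y. y \<in> {0..<1} \<Longrightarrow> g y \<in> cantor_set r"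
    and g: "\<And>y y'. y \<in> {0..<1} \<Longrightarrow> y' \<in> {0..<1} \<Longrightarrow> \<kappa> * \<bar>y - y'\<bar> powr (1 / \<mu>) \<le> \<bar>g y - g y'\<bar>"
    using exists_cantor_parametrization[OF \<mu>] unfolding r_def by metis
  show ?thesis
    unfolding r_def[symmetric]
  proof (rule le_hausdorff_dim_of_expanding_map[where g = "\<lambda>y. F (g y + a)" and \<kappa> = "c * \<kappa> powr \<theta>"])
    show "0 < \<mu> / \<theta>" "0 < c * \<kappa> powr \<theta>" using \<mu> \<theta> c \<kappa> by auto
    show "F (g y + a) \<in> F ` two_cantor_sets r" if "y \<in> {0..<1}" for y
      using gC[OF that] a by (auto simp: two_cantor_sets_def)
    show "ennreal (c * \<kappa> powr \<theta> * \<bar>y - y'\<bar> powr (1 / (\<mu> / \<theta>))) \<le> d (F (g y + a)) (F (g y' + a))"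
      if y: "y \<in> {0..<1}" "y' \<in> {0..<1}" for y y'
    proof -
      have "\<kappa> powr \<theta> * \<bar>y - y'\<bar> powr (1 / (\<mu> / \<theta>)) = (\<kappa> * \<bar>y - y'\<bar> powr (1 / \<mu>)) powr \<theta>"
        using \<kappa> by (simp add: powr_mult powr_powr)
      also have "\<dots> \<le> \<bar>g y - g y'\<bar> powr \<theta>"
        using g[OF y] \<theta> \<kappa> by (intro powr_mono2) auto
      finally have "c * \<kappa> powr \<theta> * \<bar>y - y'\<bar> powr (1 / (\<mu> / \<theta>)) \<le> c * \<bar>g y - g y'\<bar> powr \<theta>"
        using c by (simp add: mult.assoc)
      then show ?thesis
        using expand[of "g y" "g y'"] gC[OF y(1)] gC[OF y(2)] cantor_set_subset[of r]
        by (meson ennreal_leI order_trans subsetD)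
    qed
  qed
qed

section \<open>The jets of a monomial and their vertical images\<close>

text \<open>
The \<open>k\<close>-jet of \<open>x ^ (k + 1) / fact (k + 1)\<close>.
\<close>

definition monomial_jet :: "nat \<Rightarrow> real \<Rightarrow> jet" where
  "monomial_jet k x = (x, \<lambda>s. if s \<le> k then x ^ (k + 1 - s) / fact (k + 1 - s) else 0)"

lemma monomial_jet_in_jet_space: "monomial_jet k x \<in> jet_space k"
  by (simp add: monomial_jet_def jet_space_def)

lemma continuous_on_monomial_jet: "continuous_on A (monomial_jet k)"
  unfolding monomial_jet_def
proof (intro continuous_on_Pair continuous_on_id continuous_on_coordinatewise_then_product)
  show "continuous_on A (\<lambda>x. if s \<le> k then x ^ (k + 1 - s) / fact (k + 1 - s) else 0 :: real)" for s
    by (cases "s \<le> k") (auto intro!: continuous_intros)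
qed

text \<open>
The jets form an integral curve of the sum of the two frame fields. At half speed it has norm less
than \<open>1\<close>, whence the factor \<open>2\<close>.
\<close>

lemma d_cc_monomial_jet_le: "d_cc k (monomial_jet k x) (monomial_jet k x') \<le> ennreal (2 * \<bar>x' - x\<bar>)"
proof -
  define \<sigma> where "\<sigma> = sgn (x' - x)"
  define \<gamma> where "\<gamma> \<tau> = monomial_jet k (x + \<sigma> / 2 * \<tau>)" for \<tau>
  have "joins k (\<gamma> 0) (\<gamma> (2 * \<bar>x' - x\<bar>)) (2 * \<bar>x' - x\<bar>)"
  proof (rule joins_of_constant_controls[where \<alpha> = "\<sigma> / 2" and \<beta> = "\<sigma> / 2"])
    show "\<gamma> \<tau> \<in> jet_space k" for \<tau> by (simp add: \<gamma>_def monomial_jet_in_jet_space)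
    show "has_velocity \<gamma> (frame_comb k (\<gamma> \<tau>) (\<sigma> / 2) (\<sigma> / 2)) \<tau>" for \<tau>
      unfolding has_velocity_def
    proof (intro conjI allI)
      show "((\<lambda>r. fst (\<gamma> r)) has_real_derivative fst (frame_comb k (\<gamma> \<tau>) (\<sigma> / 2) (\<sigma> / 2))) (at \<tau>)"
        by (auto simp: \<gamma>_def monomial_jet_def frame_comb_def field_X_def field_U_def intro!: derivative_eq_intros)
      have y: "((\<lambda>r. x + \<sigma> / 2 * r) has_real_derivative \<sigma> / 2) (at \<tau>)" by (auto intro!: derivative_eq_intros)
      have d: "((\<lambda>r. (x + \<sigma> / 2 * r) ^ Suc n / fact (Suc n)) has_real_derivative
          \<sigma> / 2 * ((x + \<sigma> / 2 * \<tau>) ^ n / fact n)) (at \<tau>)" for n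
      proof -
        have "real (Suc n) * (\<sigma> / 2 * (x + \<sigma> / 2 * \<tau>) ^ n) / fact (Suc n) = \<sigma> / 2 * ((x + \<sigma> / 2 * \<tau>) ^ n / fact n)"
          by (simp add: divide_simps)
        then show ?thesis using DERIV_cdivide[OF DERIV_power[OF y, of "Suc n"], of "fact (Suc n)"] by simp
      qed
      show "((\<lambda>r. snd (\<gamma> r) s) has_real_derivative snd (frame_comb k (\<gamma> \<tau>) (\<sigma> / 2) (\<sigma> / 2)) s) (at \<tau>)" for s
      proof (cases s k rule: linorder_cases)
        case less
        then have "k + 1 - s = Suc (k - s)" "k + 1 - (s + 1) = k - s" by auto
        then show ?thesis using d[of "k - s"] less
          by (simp add: mult_ac \<gamma>_def monomial_jet_def frame_comb_def field_X_def field_U_def)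
      next
        case equal
        then show ?thesis using y by (simp add: \<gamma>_def monomial_jet_def frame_comb_def field_X_def field_U_def)
      next
        case greater
        then show ?thesis by (simp add: \<gamma>_def monomial_jet_def frame_comb_def field_X_def field_U_def)
      qed
    qed
  qed (auto simp: \<sigma>_def sgn_if power2_eq_square)
  then have "d_cc k (\<gamma> 0) (\<gamma> (2 * \<bar>x' - x\<bar>)) \<le> ennreal (2 * \<bar>x' - x\<bar>)" by (rule d_cc_le_of_joins)
  moreover have "\<gamma> (2 * \<bar>x' - x\<bar>) = monomial_jet k x'" by (simp add: \<gamma>_def \<sigma>_def mult_sgn_abs)
  ultimately show ?thesis by (simp add: \<gamma>_def)
qed

lemma inv_jet_of_affine:
  assumes k: "k \<ge> 1" and f: "\<And>x. f x = m * x + b"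
  shows "inv\<^bsub>jet_group k\<^esub> (jet_of k f y) = (- y, \<lambda>s. if s = 0 then - b else if s = 1 then - m else 0)"
proof -
  have f': "f = (\<lambda>x. m * x + b)" using f by auto
  have d1: "deriv f = (\<lambda>_. m)"
    unfolding f' by (rule ext, rule DERIV_imp_deriv) (auto intro!: derivative_eq_intros)
  have d2: "(deriv ^^ s) (\<lambda>_. m) = (\<lambda>_. 0)" if "s > 0" for s
    using that by (induction s rule: nat_induct_non_zero) (auto intro!: ext DERIV_imp_deriv derivative_eq_intros)
  have der: "(deriv ^^ s) f x = (if s = 0 then m * x + b else if s = 1 then m else 0)" for s x
  proof (cases s)
    case (Suc n)
    then have "(deriv ^^ s) f = (deriv ^^ n) (\<lambda>_. m)" by (simp add: funpow_swap1 d1 funpow_Suc_right del: funpow.simps)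
    then show ?thesis using Suc d2[of n] by (cases n) auto
  qed (simp add: f)
  define q where "q = jet_of k f y"
  define q' where "q' = (- y, \<lambda>s::nat. if s = 0 then - b else if s = 1 then - m else 0)"
  have q: "fst q = y" "snd q s = (if s = 0 then m * y + b else if s = 1 then m else 0)" for s
    using k by (auto simp: q_def jet_of_def der d1 f)
  have one: "(\<Sum>j\<in>{s + 1..k}. (if j = 0 then A else if j = 1 then B else 0) * G j) = (if s = 0 then B * G 1 else 0)"
    for s and A B :: real and G :: "nat \<Rightarrow> real"
  proof -
    have "(\<Sum>j\<in>{s + 1..k}. (if j = 0 then A else if j = 1 then B else 0) * G j) = (\<Sum>j\<in>{s + 1..k}. if j = 1 then B * G 1 else 0)"
      by (rule sum.cong) auto
    also have "\<dots> = (if s = 0 then B * G 1 else 0)" using k by (simp add: sum.delta)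
    finally show ?thesis .
  qed
  have q': "fst q' = - y" "snd q' s = (if s = 0 then - b else if s = 1 then - m else 0)" for s
    by (simp_all add: q'_def)
  have sums: "(\<Sum>j\<in>{s+1..k}. snd q j * (z ^ (j - s) / fact (j - s))) = (if s = 0 then m * z else 0)"
    "(\<Sum>j\<in>{s+1..k}. snd q' j * (z ^ (j - s) / fact (j - s))) = (if s = 0 then - m * z else 0)" for s z
    unfolding q(2) q'(2) one by simp_all
  have qq': "jet_mult k q q' = (0, \<lambda>_. 0)" "jet_mult k q' q = (0, \<lambda>_. 0)"
    unfolding jet_mult_def sums by (auto simp: q q' fun_eq_iff)
  have uniq: "z = q'" if z: "jet_mult k q z = (0, \<lambda>_. 0)" for z
  proof -
    have e: "fst q + fst z = fst q + fst q'" using z qq'(1) by (simp add: jet_mult_def)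
    have "snd q s + snd z s + (\<Sum>j\<in>{s+1..k}. snd q j * (fst z ^ (j - s) / fact (j - s)))
       = snd q s + snd q' s + (\<Sum>j\<in>{s+1..k}. snd q j * (fst q' ^ (j - s) / fact (j - s)))" for s
      using z qq'(1) unfolding jet_mult_def by (metis (no_types, lifting) snd_conv)
    then show ?thesis using e by (auto simp: prod_eq_iff fun_eq_iff)
  qed
  have "q' \<in> jet_space k" using k by (auto simp: q'_def jet_space_def)
  then have "inv\<^bsub>jet_group k\<^esub> q = q'"
    unfolding m_inv_def
  proof (intro the_equality)
    fix z assume "z \<in> carrier (jet_group k) \<and> q \<otimes>\<^bsub>jet_group k\<^esub> z = \<one>\<^bsub>jet_group k\<^esub> \<and> z \<otimes>\<^bsub>jet_group k\<^esub> q = \<one>\<^bsub>jet_group k\<^esub>"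
    then have "jet_mult k q z = (0, \<lambda>_. 0)" by (simp add: jet_group_def)
    then show "z = q'" by (rule uniq)
  qed (simp add: jet_group_def qq')
  then show ?thesis by (simp add: q_def q'_def)
qed

text \<open>
Multiplication in the group transports the jet at \<open>x\<close> to \<open>t\<close> by Taylor
expansion to order \<open>k\<close>. The full binomial expansion of \<open>t = x + (t - x)\<close>
in the coordinate \<open>u\<^sub>s\<close> has one more term, \<open>(t - x) ^ (k + 1 -
s)\<close>, which is the error.
\<close>

lemma vertical_map_monomial_jet:
  assumes k: "k \<ge> 1" and f: "\<And>x. f x = m * x + b"
  shows "vertical_map k f t (monomial_jet k x) = (t, \<lambda>s. if s \<le> k then
     (t ^ (k + 1 - s) - (t - x) ^ (k + 1 - s)) / fact (k + 1 - s) + (if s = 0 then - b else if s = 1 then - m else 0)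
     else 0)"
proof -
  let ?u = "\<lambda>s. x ^ (k + 1 - s) / fact (k + 1 - s) :: real"
  let ?y = "t - x"
  have tay: "?u s + (\<Sum>j\<in>{s+1..k}. ?u j * (?y ^ (j - s) / fact (j - s)))
      = (t ^ (k + 1 - s) - ?y ^ (k + 1 - s)) / fact (k + 1 - s)" if s: "s \<le> k" for s
  proof -
    have n: "k + 1 - s = Suc (k - s)" using s by simp
    have "t ^ (k + 1 - s) / fact (k + 1 - s)
        = (\<Sum>i\<le>k - s. x ^ (k + 1 - s - i) / fact (k + 1 - s - i) * (?y ^ i / fact i)) + ?y ^ (k + 1 - s) / fact (k + 1 - s)"
      using exponential_binomial[where n = "k + 1 - s" and a = x and b = ?y, symmetric] unfolding n by simp
    also have "(\<Sum>i\<le>k - s. x ^ (k + 1 - s - i) / fact (k + 1 - s - i) * (?y ^ i / fact i))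
        = (\<Sum>j\<in>{s..k}. ?u j * (?y ^ (j - s) / fact (j - s)))"
      by (rule sum.reindex_bij_witness[of _ "\<lambda>j. j - s" "\<lambda>i. s + i"]) (use s in auto)
    also have "\<dots> = ?u s + (\<Sum>j\<in>{s+1..k}. ?u j * (?y ^ (j - s) / fact (j - s)))"
      using s by (simp add: sum.atLeast_Suc_atMost)
    finally show ?thesis by (simp add: diff_divide_distrib)
  qed
  have sum: "(\<Sum>j\<in>{s+1..k}. snd (monomial_jet k x) j * (?y ^ (j - s) / fact (j - s)))
     = (\<Sum>j\<in>{s+1..k}. ?u j * (?y ^ (j - s) / fact (j - s)))" for s
    by (rule sum.cong) (auto simp: monomial_jet_def)
  have "snd (vertical_map k f t (monomial_jet k x)) s = (if s \<le> k then
     (t ^ (k + 1 - s) - ?y ^ (k + 1 - s)) / fact (k + 1 - s) + (if s = 0 then - b else if s = 1 then - m else 0)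
     else 0)" for s
  proof -
    have "snd (vertical_map k f t (monomial_jet k x)) s = snd (monomial_jet k x) s
        + (if s = 0 then - b else if s = 1 then - m else 0)
        + (\<Sum>j\<in>{s+1..k}. snd (monomial_jet k x) j * (?y ^ (j - s) / fact (j - s)))"
      unfolding vertical_map_def inv_jet_of_affine[OF k f] by (simp add: jet_group_def jet_mult_def monomial_jet_def)
    also have "\<dots> = (if s \<le> k then
     (t ^ (k + 1 - s) - ?y ^ (k + 1 - s)) / fact (k + 1 - s) + (if s = 0 then - b else if s = 1 then - m else 0)
     else 0)"
    proof (cases "s \<le> k")
      case True
      then show ?thesis unfolding sum using tay[OF True] by (simp add: monomial_jet_def algebra_simps)
    next
      case False
      then show ?thesis using k by (simp add: monomial_jet_def)
    qed
    finally show ?thesis .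
  qed
  moreover have "fst (vertical_map k f t (monomial_jet k x)) = t"
    unfolding vertical_map_def inv_jet_of_affine[OF k f] by (simp add: jet_group_def jet_mult_def monomial_jet_def)
  ultimately show ?thesis by (simp add: prod_eq_iff fun_eq_iff)
qed

lemma power_diff_le:
  fixes a b M :: real
  assumes "\<bar>a\<bar> \<le> M" "\<bar>b\<bar> \<le> M" "1 \<le> M"
  shows "\<bar>a ^ n - b ^ n\<bar> \<le> real n * M ^ n * \<bar>a - b\<bar>"
proof (induction n)
  case (Suc n)
  have "a ^ Suc n - b ^ Suc n = a * (a ^ n - b ^ n) + (a - b) * b ^ n" by (simp add: algebra_simps)
  then have "\<bar>a ^ Suc n - b ^ Suc n\<bar> \<le> \<bar>a\<bar> * \<bar>a ^ n - b ^ n\<bar> + \<bar>a - b\<bar> * \<bar>b\<bar> ^ n"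
    by (metis abs_mult abs_triangle_ineq power_abs)
  also have "\<dots> \<le> M * (real n * M ^ n * \<bar>a - b\<bar>) + \<bar>a - b\<bar> * M ^ Suc n"
  proof (intro add_mono mult_mono Suc.IH)
    have "\<bar>b\<bar> ^ n \<le> M ^ n" using assms by (intro power_mono) auto
    also have "\<dots> \<le> M ^ Suc n" using assms by (intro power_increasing) auto
    finally show "\<bar>b\<bar> ^ n \<le> M ^ Suc n" .
  qed (use assms in auto)
  also have "\<dots> = real (Suc n) * M ^ Suc n * \<bar>a - b\<bar>" by (simp add: algebra_simps)
  finally show ?case .
qed simp

lemma power_diff_ge:
  fixes a b :: real
  assumes "1 \<le> a" "1 \<le> b"
  shows "\<bar>a - b\<bar> \<le> \<bar>a ^ Suc n - b ^ Suc n\<bar>"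
proof -
  have main: "a - b \<le> a ^ Suc n - b ^ Suc n" if "b \<le> a" "1 \<le> b" for a b :: real
  proof (induction n)
    case (Suc n)
    have "0 \<le> (a - 1) * (a ^ Suc n - b ^ Suc n)" using that by (intro mult_nonneg_nonneg) (auto intro!: power_mono simp del: power_Suc)
    moreover have "0 \<le> (a - b) * b ^ Suc n" using that by (intro mult_nonneg_nonneg) auto
    moreover have "a ^ Suc (Suc n) - b ^ Suc (Suc n) = (a ^ Suc n - b ^ Suc n) + (a - 1) * (a ^ Suc n - b ^ Suc n) + (a - b) * b ^ Suc n"
      by (simp add: algebra_simps)
    ultimately show ?case using Suc.IH by linarith
  qed simp
  show ?thesis
    using main[of a b] main[of b a] assms by (cases "b \<le> a") (auto simp: abs_if simp del: power_Suc)
qed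

text \<open>
The displacement of the coordinate \<open>u\<^sub>s\<close> is at most \<open>L * \<bar>x -
x'\<bar>\<close>. As \<open>L \<ge> 1\<close> and \<open>\<bar>x - x'\<bar> \<le> 1\<close>, it
fits the box of size \<open>h = L * \<bar>x - x'\<bar> powr (1 / (k + 1))\<close>: the most
restrictive coordinate is \<open>u\<^sub>0\<close>, with \<open>h ^ (k + 1) \<ge> L * \<bar>x -
x'\<bar>\<close>.
\<close>

lemma vertical_image_hoelder:
  assumes k: "k \<ge> 1" and f: "\<And>x. f x = m * x + b"
  obtains K where "0 < K" "\<And>x x'. x \<in> {0..4} \<Longrightarrow> x' \<in> {0..4} \<Longrightarrow> \<bar>x - x'\<bar> \<le> 1 \<Longrightarrow>
     d_cc k (vertical_map k f t (monomial_jet k x)) (vertical_map k f t (monomial_jet k x'))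
       \<le> ennreal (K * \<bar>x - x'\<bar> powr (1 / real (k + 1)))"
proof -
  obtain C where C: "C > 0" and box: "\<And>t u \<delta> h. 0 < h \<Longrightarrow> (\<And>s. s > k \<Longrightarrow> u s = 0 \<and> \<delta> s = 0) \<Longrightarrow>
      (\<And>s. s \<le> k \<Longrightarrow> \<bar>\<delta> s\<bar> \<le> h ^ (k + 1 - s)) \<Longrightarrow> d_cc k (t, u) (t, \<lambda>s. u s + \<delta> s) \<le> ennreal (C * h)"
    by (rule fibre_box_in_ball[of k]) blast
  define M where "M = \<bar>t\<bar> + 4"
  define L where "L = real (k + 1) * M ^ (k + 1)"
  have M: "1 \<le> M" by (simp add: M_def)
  have "1 * 1 \<le> L" unfolding L_def using M by (intro mult_mono one_le_power) auto
  then have L: "1 \<le> L" by simp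
  show ?thesis
  proof (rule that[of "C * L"])
    show "0 < C * L" using C L by simp
    fix x x' :: real assume x: "x \<in> {0..4}" "x' \<in> {0..4}" and close: "\<bar>x - x'\<bar> \<le> 1"
    let ?V = "\<lambda>x. vertical_map k f t (monomial_jet k x)"
    show "d_cc k (?V x) (?V x') \<le> ennreal (C * L * \<bar>x - x'\<bar> powr (1 / real (k + 1)))"
    proof (cases "x = x'")
      case True
      have "?V x \<in> jet_space k" by (simp add: vertical_map_monomial_jet[OF k f] jet_space_def)
      then have "joins k (?V x) (?V x) 0" by (rule joins_refl)
      then have "d_cc k (?V x) (?V x) \<le> 0" using d_cc_le_of_joins by fastforce
      then show ?thesis using True by simp
    next
      case False
      define h where "h = L * \<bar>x - x'\<bar> powr (1 / real (k + 1))"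
      have h: "0 < h" using L False by (simp add: h_def)
      define u where "u = snd (?V x)"
      define \<delta> where "\<delta> s = (if s \<le> k then ((t - x) ^ (k + 1 - s) - (t - x') ^ (k + 1 - s)) / fact (k + 1 - s) else 0)" for s
      have Vx: "?V x = (t, u)" by (simp add: u_def vertical_map_monomial_jet[OF k f])
      have Vx': "?V x' = (t, \<lambda>s. u s + \<delta> s)"
        by (auto simp: u_def \<delta>_def vertical_map_monomial_jet[OF k f] fun_eq_iff diff_divide_distrib)
      have "d_cc k (t, u) (t, \<lambda>s. u s + \<delta> s) \<le> ennreal (C * h)"
      proof (rule box[OF h])
        show "u s = 0 \<and> \<delta> s = 0" if "s > k" for s
          using that by (simp add: u_def \<delta>_def vertical_map_monomial_jet[OF k f])
        fix s assume s: "s \<le> k"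
        define n where "n = k + 1 - s"
        have n: "1 \<le> n" "n \<le> k + 1" using s by (auto simp: n_def)
        have "\<bar>\<delta> s\<bar> = \<bar>(t - x) ^ n - (t - x') ^ n\<bar> / fact n" using s by (simp add: \<delta>_def n_def)
        also have "\<dots> \<le> \<bar>(t - x) ^ n - (t - x') ^ n\<bar> / 1" by (intro divide_left_mono) (auto simp: fact_ge_1)
        also have "\<dots> \<le> real n * M ^ n * \<bar>(t - x) - (t - x')\<bar>"
          using power_diff_le[of "t - x" M "t - x'" n] x M by (auto simp: M_def)
        also have "\<dots> = real n * M ^ n * \<bar>x - x'\<bar>" by (simp add: abs_minus_commute)
        also have "\<dots> \<le> L * \<bar>x - x'\<bar>"
          unfolding L_def using n M by (intro mult_right_mono mult_mono power_increasing) auto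
        also have "\<dots> \<le> L ^ n * (\<bar>x - x'\<bar> powr (1 / real (k + 1))) ^ n"
        proof (intro mult_mono)
          show "L \<le> L ^ n" using power_increasing[OF n(1) L] by simp
          have "\<bar>x - x'\<bar> powr 1 \<le> \<bar>x - x'\<bar> powr (real n / real (k + 1))"
            using n close by (intro powr_mono') (auto simp: divide_simps)
          also have "\<dots> = (\<bar>x - x'\<bar> powr (1 / real (k + 1))) ^ n"
            using False by (simp add: powr_realpow[symmetric] powr_powr)
          finally show "\<bar>x - x'\<bar> \<le> (\<bar>x - x'\<bar> powr (1 / real (k + 1))) ^ n" by simp
        qed (use L in auto)
        finally show "\<bar>\<delta> s\<bar> \<le> h ^ (k + 1 - s)" by (simp add: h_def power_mult_distrib n_def)
      qed
      then show ?thesis by (simp add: Vx Vx' h_def mult.assoc)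
    qed
  qed
qed

text \<open>
The power \<open>(t - x) ^ (k + 1)\<close> in \<open>u\<^sub>0\<close> is expanding away from its
critical point \<open>x = t\<close>.
\<close>

lemma vertical_image_expanding:
  assumes k: "k \<ge> 1" and f: "\<And>x. f x = m * x + b"
    and far: "1 \<le> t - x \<and> 1 \<le> t - x' \<or> 1 \<le> x - t \<and> 1 \<le> x' - t"
  shows "ennreal ((1 / real (k + 1)) powr (1 / real (k + 1)) * \<bar>x - x'\<bar> powr (1 / real (k + 1)))
     \<le> d_cc k (vertical_map k f t (monomial_jet k x)) (vertical_map k f t (monomial_jet k x'))"
proof -
  let ?V = "\<lambda>x. vertical_map k f t (monomial_jet k x)"
  have "\<bar>x - x'\<bar> \<le> \<bar>(t - x) ^ Suc k - (t - x') ^ Suc k\<bar>"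
    using far
  proof
    assume "1 \<le> t - x \<and> 1 \<le> t - x'"
    then show ?thesis using power_diff_ge[of "t - x" "t - x'" k] by simp
  next
    assume "1 \<le> x - t \<and> 1 \<le> x' - t"
    then have "\<bar>x - x'\<bar> \<le> \<bar>(x - t) ^ Suc k - (x' - t) ^ Suc k\<bar>"
      using power_diff_ge[of "x - t" "x' - t" k] by simp
    also have "\<dots> = \<bar>(-1) ^ Suc k * ((x - t) ^ Suc k - (x' - t) ^ Suc k)\<bar>" by (simp add: abs_mult power_abs del: power_Suc)
    also have "(-1) ^ Suc k * ((x - t) ^ Suc k - (x' - t) ^ Suc k) = (t - x) ^ Suc k - (t - x') ^ Suc k"
      unfolding right_diff_distrib power_mult_distrib[symmetric] by simp
    finally show ?thesis .
  qed
  also have "\<dots> = real (k + 1) * (fact k * \<bar>snd (?V x) 0 - snd (?V x') 0\<bar>)"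
  proof -
    have "snd (?V x) 0 - snd (?V x') 0 = ((t - x') ^ Suc k - (t - x) ^ Suc k) / fact (Suc k)"
      by (simp add: vertical_map_monomial_jet[OF k f] diff_divide_distrib)
    then have "fact (Suc k) * \<bar>snd (?V x) 0 - snd (?V x') 0\<bar> = \<bar>(t - x) ^ Suc k - (t - x') ^ Suc k\<bar>"
      by (simp add: abs_minus_commute del: fact_Suc power_Suc)
    then show ?thesis by (simp add: mult.assoc)
  qed
  finally have "1 / real (k + 1) * \<bar>x - x'\<bar> \<le> fact k * \<bar>snd (?V x) 0 - snd (?V x') 0\<bar>"
    by (simp add: divide_simps mult.commute)
  then have "(1 / real (k + 1) * \<bar>x - x'\<bar>) powr (1 / real (k + 1))
      \<le> (fact k * \<bar>snd (?V x) 0 - snd (?V x') 0\<bar>) powr (1 / real (k + 1))"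
    by (intro powr_mono2) auto
  moreover have "(1 / real (k + 1) * \<bar>x - x'\<bar>) powr (1 / real (k + 1))
      = (1 / real (k + 1)) powr (1 / real (k + 1)) * \<bar>x - x'\<bar> powr (1 / real (k + 1))"
    by (rule powr_mult)
  ultimately have "ennreal ((1 / real (k + 1)) powr (1 / real (k + 1)) * \<bar>x - x'\<bar> powr (1 / real (k + 1)))
      \<le> ennreal ((fact k * \<bar>snd (?V x) 0 - snd (?V x') 0\<bar>) powr (1 / real (k + 1)))"
    by (intro ennreal_leI) (simp only:)
  also have "\<dots> \<le> d_cc k (?V x) (?V x')"
    by (rule vertical_diff_le_d_cc) (simp add: vertical_map_monomial_jet[OF k f])
  finally show ?thesis .
qed

theorem proposition5p3:
  fixes k :: nat and f :: "real \<Rightarrow> real" and m b \<mu> :: real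
  assumes "k \<ge> 1"
    and "\<And>x. f x = m * x + b"
    and "m \<noteq> 0"
    and "0 \<le> \<mu>" and "\<mu> \<le> 1"
  shows "\<exists>E. E \<subseteq> jet_space k \<and> E \<in> sets borel \<and>
           (\<forall>t::real. jet_dim k E = ennreal \<mu> \<and>
              jet_dim k (vertical_map k f t ` E) = ennreal (real (k + 1) * \<mu>))"
proof (cases "\<mu> = 0")
  case True
  then show ?thesis by (intro exI[of _ "{}"]) (simp add: hausdorff_dim_empty)
next
  case False
  then have \<mu>: "0 < \<mu>" "\<mu> \<le> 1" using assms by auto
  define A where "A = two_cantor_sets (2 powr (- 1 / \<mu>))"
  define E where "E = monomial_jet k ` A"
  have borel: "E \<in> sets borel"
  proof -
    have "compact E" unfolding E_def A_def
      by (intro compact_continuous_image continuous_on_monomial_jet compact_two_cantor_sets)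
    then show ?thesis by (intro borel_closed compact_imp_closed)
  qed
  have "jet_dim k E \<le> ennreal (\<mu> / 1)"
    unfolding E_def A_def
    by (rule hausdorff_dim_hoelder_image_le[where K = 2])
      (use \<mu> d_cc_monomial_jet_le[of k] in \<open>auto simp: monomial_jet_in_jet_space abs_minus_commute\<close>)
  moreover have "ennreal (\<mu> / 1) \<le> jet_dim k E"
    unfolding E_def A_def
  proof (rule hausdorff_dim_expanding_image_ge[where c = 1 and a = 0])
    show "ennreal (1 * \<bar>x - x'\<bar> powr 1) \<le> d_cc k (monomial_jet k (x + 0)) (monomial_jet k (x' + 0))" for x x'
      using fst_diff_le_d_cc[of "monomial_jet k x" "monomial_jet k x'" k] by (simp add: monomial_jet_def)
  qed (use \<mu> in auto)
  ultimately have dimE: "jet_dim k E = ennreal \<mu>" by simp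
  have dimV: "jet_dim k (vertical_map k f t ` E) = ennreal (real (k + 1) * \<mu>)" for t
  proof -
    let ?V = "\<lambda>x. vertical_map k f t (monomial_jet k x)" and ?\<theta> = "1 / real (k + 1)"
    have img: "vertical_map k f t ` E = ?V ` A" by (simp add: E_def image_image)
    obtain K where K: "0 < K" "\<And>x x'. x \<in> {0..4} \<Longrightarrow> x' \<in> {0..4} \<Longrightarrow> \<bar>x - x'\<bar> \<le> 1 \<Longrightarrow>
       d_cc k (?V x) (?V x') \<le> ennreal (K * \<bar>x - x'\<bar> powr ?\<theta>)"
      by (rule vertical_image_hoelder[OF assms(1,2)]) blast
    have "jet_dim k (?V ` A) \<le> ennreal (\<mu> / ?\<theta>)"
      unfolding A_def
    proof (rule hausdorff_dim_hoelder_image_le[where K = K])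
      show "d_cc k (?V x) (?V x') \<le> ennreal (K * \<bar>x - x'\<bar> powr ?\<theta>)"
        if "x \<in> {0..4}" "x' \<in> {0..4}" "\<bar>x - x'\<bar> \<le> 1" for x x' using that by (rule K(2))
      show "?V x \<in> jet_space k" for x by (simp add: vertical_map_monomial_jet[OF assms(1,2)] jet_space_def)
    qed (use \<mu> K in auto)
    moreover have "ennreal (\<mu> / ?\<theta>) \<le> jet_dim k (?V ` A)"
      unfolding A_def
    \<comment> \<open>The unit interval is at distance at least \<open>1\<close> from \<open>t \<ge> 2\<close>, its translate by \<open>3\<close> from \<open>t < 2\<close>.\<close>
    proof (rule hausdorff_dim_expanding_image_ge[OF \<mu>, where c = "?\<theta> powr ?\<theta>" and a = "if t \<ge> 2 then 0 else 3"])
      fix x x' :: real assume "x \<in> {0..1}" "x' \<in> {0..1}"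
      then show "ennreal (?\<theta> powr ?\<theta> * \<bar>x - x'\<bar> powr ?\<theta>)
          \<le> d_cc k (?V (x + (if t \<ge> 2 then 0 else 3))) (?V (x' + (if t \<ge> 2 then 0 else 3)))"
        using vertical_image_expanding[OF assms(1,2), of t "x + (if t \<ge> 2 then 0 else 3)" "x' + (if t \<ge> 2 then 0 else 3)"]
        by (auto split: if_splits)
    qed auto
    ultimately show ?thesis by (simp add: img mult.commute)
  qed
  show ?thesis
    using borel dimE dimV by (intro exI[of _ E]) (auto simp: E_def monomial_jet_in_jet_space)
qed

end
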